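(* Let $m\ge2$ and let $(\sigma_1,\ldots,\sigma_m)$ generate the Nikishin system $\mathcal{N}(\sigma_1,\ldots,\sigma_m)$. For each $n\in\mathbb{N}$ let $(a_{n,0},\ldots,a_{n,m})$ be a vector of ML Hermite-Padé polynomials of $\mathcal{N}(\sigma_1,\ldots,\sigma_m)$, and for each $k\in\mathbb{N}$ let $(b_{k,0},\ldots,b_{k,m})$ be a vector of ML Hermite-Padé polynomials of the reversed Nikishin system $\mathcal{N}(\sigma_m,\ldots,\sigma_1)$. Then the sequences $(a_{n,m})_{n\in\mathbb{N}}$ and $(b_{k,m})_{k\in\mathbb{N}}$ are biorthogonal with respect to the Cauchy convolution kernel $K$ and the measures $(\sigma_1,\ldots,\sigma_m)$; that is, for all $n,k\in\mathbb{N}$, $$\int_{\Delta_1}\int_{\Delta_m} b_{k,m}(x_1)\,K(x_1,x_m)\,a_{n,m}(x_m)\,d\sigma_m(x_m)\,d\sigma_1(x_1)=h_n\,\delta_{n,k},\qquad h_n\neq0,$$ where $\delta_{n,k}=0$ for $k\ne n$ and $\delta_{n,n}=1$.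
   Context: $\mathbb{N}=\{1,2,\ldots\}$. For an interval $\Delta\subset\mathbb{R}$, $\mathcal{M}(\Delta)$ is the class of Borel measures $s$ of constant sign whose support consists of infinitely many points and is contained in $\Delta$, with $x^\nu\in L_1(s)$ for all integers $\nu\ge0$. The Cauchy transform is $\widehat{s}(z)=\int\frac{ds(x)}{z-x}$; it has the expansion $\widehat{s}(z)\sim\sum_{j\ge0}c_j/z^{j+1}$, $c_j=\int x^j\,ds(x)$, at $\infty$, convergent near $\infty$ if the support is bounded and otherwise asymptotic (limits taken along curves non-tangential to the support at $\infty$). All symbols $\mathcal{O}(1/z^N)$ refer to $z\to\infty$ in this sense. For $\sigma_\alpha\in\mathcal{M}(\Delta_\alpha)$, $\sigma_\beta\in\mathcal{M}(\Delta_\beta)$, with $\Delta_\alpha,\Delta_\beta$ having at most one common point and $\widehat\sigma_\beta\in L_1(\sigma_\alpha)$, define the measure $d\langle\sigma_\alpha,\sigma_\beta\rangle(x):=\widehat\sigma_\beta(x)\,d\sigma_\alpha(x)$. Longer products are defined recursively, $\langle\sigma_j,\sigma_{j+1},\ldots,\sigma_k\rangle:=\langle\sigma_j,\langle\sigma_{j+1},\ldots,\sigma_k\rangle\rangle$. Let $\Delta_1,\ldots,\Delta_m$ be intervals in $\mathbb{R}$ such that for each $j=1,\ldots,m-1$ either $\Delta_j\cap\Delta_{j+1}=\emptyset$ or $\Delta_j\cap\Delta_{j+1}=\{x_{j,j+1}\}$ is a single point. Let $\sigma_j\in\mathcal{M}(\Delta_j)$ with the convex hull of $\operatorname{supp}(\sigma_j)$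 equal to $\Delta_j$, $j=1,\ldots,m$; if $\Delta_j\cap\Delta_{j+1}=\{x_{j,j+1}\}$, then $x_{j,j+1}$ is not a mass point of $\sigma_j$ or of $\sigma_{j+1}$. For $1\le j\le k\le m$ put $s_{j,k}:=\langle\sigma_j,\sigma_{j+1},\ldots,\sigma_k\rangle$ and $s_{k,j}:=\langle\sigma_k,\sigma_{k-1},\ldots,\sigma_j\rangle$ (so $s_{j,j}=\sigma_j$). All these products are assumed well defined (the required integrability holds), with $s_{j,k}\in\mathcal{M}(\Delta_j)$ and $s_{k,j}\in\mathcal{M}(\Delta_k)$. The system $(s_{1,1},\ldots,s_{1,m})=\mathcal{N}(\sigma_1,\ldots,\sigma_m)$ is the Nikishin system generated by $(\sigma_1,\ldots,\sigma_m)$, and $(s_{m,m},\ldots,s_{m,1})=\mathcal{N}(\sigma_m,\ldots,\sigma_1)$ is the reversed one. ML (multi-level) Hermite-Padé polynomials of $\mathcal{N}(\sigma_1,\ldots,\sigma_m)$: for $n\in\mathbb{N}$, polynomials $a_{n,0},\ldots,a_{n,m}$, not all identically zero, with $\deg a_{n,j}\le n-1$ for $j=0,\ldots,m-1$ and $\deg a_{n,m}\le n$, such that, with $$\mathcal{A}_{n,j}:=(-1)^ja_{n,j}+\sum_{k=j+1}^m(-1)^k a_{n,k}\widehat s_{j+1,k},\qquad j=0,\ldots,m-1,$$ one has $\mathcal{A}_{n,0}(z)=\mathcal{O}(1/z^{n+1})$ and $\mathcal{A}_{n,j}(z)=\mathcal{O}(1/z)$ for $j=1,\ldots,m-1$.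 They exist for every $n$ and (up to constant multiples) are unique. ML Hermite-Padé polynomials of the reversed system $\mathcal{N}(\sigma_m,\ldots,\sigma_1)$: polynomials $b_{n,0},\ldots,b_{n,m}$, not all identically zero, with $\deg b_{n,j}\le n-1$ for $j=0,\ldots,m-1$ and $\deg b_{n,m}\le n$, such that, with $$\mathcal{B}_{n,j}:=(-1)^jb_{n,j}+\sum_{k=j+1}^m(-1)^k b_{n,k}\widehat s_{m-j,m-k+1},\qquad j=0,\ldots,m-1,$$ one has $\mathcal{B}_{n,0}(z)=\mathcal{O}(1/z^{n+1})$ and $\mathcal{B}_{n,j}(z)=\mathcal{O}(1/z)$ for $j=1,\ldots,m-1$. Cauchy convolution kernel: for $m=2$, $K(x_1,x_2)=\frac1{x_1-x_2}$; for $m>2$, $$K(x_1,x_m)=\int_{\Delta_2}\int_{\Delta_3}\cdots\int_{\Delta_{m-1}}\frac{d\sigma_{m-1}(x_{m-1})\cdots d\sigma_3(x_3)\,d\sigma_2(x_2)}{(x_{m-1}-x_m)(x_{m-2}-x_{m-1})\cdots(x_2-x_3)(x_1-x_2)}.$$ *)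

theory Defs
  imports "HOL-Analysis.Analysis" "HOL-Library.Landau_Symbols"
    "HOL-Computational_Algebra.Polynomial"
begin

(* A measure s of constant sign on the real line is represented as s = e * mu, with a sign
   e = msign s in {1, -1} and a nonnegative measure mu = mmod s = |s|. *)
datatype csmeasure = CSM (msign: real) (mmod: "real measure")

definition cs_integral :: "csmeasure \<Rightarrow> (real \<Rightarrow> 'a::{banach, second_countable_topology}) \<Rightarrow> 'a"
  where "cs_integral s f = msign s *\<^sub>R (\<integral>x. f x \<partial>mmod s)"

definition supp :: "csmeasure \<Rightarrow> real set"
  where "supp s = {x. \<forall>U. open U \<longrightarrow> x \<in> U \<longrightarrow> emeasure (mmod s) U > 0}"

(* The class M(D). The case \<nu> = 0 forces total mass to be finite. *)
definition class_M :: "real set \<Rightarrow> csmeasure set"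
  where "class_M D = {s. msign s \<in> {1, -1} \<and> sets (mmod s) = sets borel \<and>
     infinite (supp s) \<and> supp s \<subseteq> D \<and> (\<forall>\<nu>::nat. integrable (mmod s) (\<lambda>x. x ^ \<nu>))}"

(* Used both with complex argument and, where the integral converges, with real argument. *)
definition cauchy :: "csmeasure \<Rightarrow> 'a \<Rightarrow> 'a::{real_normed_field, banach, second_countable_topology}"
  where "cauchy s z = cs_integral s (\<lambda>x. 1 / (z - of_real x))"

(* The measure with density (cauchy s2) with respect to s1, for cauchy s2 of constant sign
   s1-almost everywhere (see csprod_defined). *)
definition csprod :: "csmeasure \<Rightarrow> csmeasure \<Rightarrow> csmeasure"
  where "csprod s1 s2 =
     CSM (if AE x in mmod s1. cauchy s2 x \<ge> 0 then msign s1 else - msign s1)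
         (density (mmod s1) (\<lambda>x. ennreal \<bar>cauchy s2 x\<bar>))"

definition csprod_defined :: "csmeasure \<Rightarrow> csmeasure \<Rightarrow> bool"
  where "csprod_defined s1 s2 \<longleftrightarrow>
     (AE x in mmod s1. integrable (mmod s2) (\<lambda>t. 1 / (x - t))) \<and>
     integrable (mmod s1) (\<lambda>x. cauchy s2 x) \<and>
     ((AE x in mmod s1. cauchy s2 x \<ge> 0) \<or> (AE x in mmod s1. cauchy s2 x \<le> 0))"

(* The empty list is a dummy case. *)
fun csprod_list :: "csmeasure list \<Rightarrow> csmeasure"
  where
    "csprod_list [] = CSM 1 (null_measure borel)"
  | "csprod_list [s] = s"
  | "csprod_list (s # ss) = csprod s (csprod_list ss)"

(* nik \<sigma> j k is s_{j,k} = <\<sigma>_j, \<sigma>_{j+1}, ..., \<sigma>_k> for j \<le> k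
   and <\<sigma>_j, \<sigma>_{j-1}, ..., \<sigma>_k> for j > k. *)
definition nik :: "(nat \<Rightarrow> csmeasure) \<Rightarrow> nat \<Rightarrow> nat \<Rightarrow> csmeasure"
  where "nik \<sigma> j k =
     csprod_list (map \<sigma> (if j \<le> k then [j..<Suc k] else rev [k..<Suc j]))"

definition nikishin_generators ::
    "nat \<Rightarrow> (nat \<Rightarrow> real set) \<Rightarrow> (nat \<Rightarrow> csmeasure) \<Rightarrow> bool"
  where "nikishin_generators m \<Delta> \<sigma> \<longleftrightarrow>
     (\<forall>j\<in>{1..m}. is_interval (\<Delta> j) \<and> \<sigma> j \<in> class_M (\<Delta> j) \<and>
        convex hull (supp (\<sigma> j)) = \<Delta> j) \<and>
     (\<forall>j\<in>{1..<m}. \<Delta> j \<inter> \<Delta> (j + 1) = {} \<or>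
        (\<exists>x. \<Delta> j \<inter> \<Delta> (j + 1) = {x} \<and>
             emeasure (mmod (\<sigma> j)) {x} = 0 \<and> emeasure (mmod (\<sigma> (j + 1))) {x} = 0)) \<and>
     (\<forall>j\<in>{1..m}. \<forall>k\<in>{j..m}.
        nik \<sigma> j k \<in> class_M (\<Delta> j) \<and> nik \<sigma> k j \<in> class_M (\<Delta> k) \<and>
        (j < k \<longrightarrow> csprod_defined (\<sigma> j) (nik \<sigma> (j + 1) k) \<and>
                    csprod_defined (\<sigma> k) (nik \<sigma> (k - 1) j)))"

(* f(z) = O(1/z^N) as z tends to infinity non-tangentially to D, i.e. within each region
   dist(z, D) \<ge> \<delta>|z|. For bounded D and \<delta> < 1 such a region contains a full punctured
   neighbourhood of infinity. *)
definition bigo_nontang :: "real set \<Rightarrow> (complex \<Rightarrow> complex) \<Rightarrow> nat \<Rightarrow> bool"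
  where "bigo_nontang D f N \<longleftrightarrow>
     (\<forall>\<delta>>0. f \<in> O[inf at_infinity
                  (principal {z. infdist z (complex_of_real ` D) \<ge> \<delta> * norm z})](\<lambda>z. 1 / z ^ N))"

definition ml_form ::
    "nat \<Rightarrow> (nat \<Rightarrow> nat \<Rightarrow> csmeasure) \<Rightarrow> (nat \<Rightarrow> complex poly) \<Rightarrow> nat \<Rightarrow> complex \<Rightarrow> complex"
  where "ml_form m S a j z =
     (-1) ^ j * poly (a j) z + (\<Sum>k = j + 1..m. (-1) ^ k * poly (a k) z * cauchy (S j k) z)"

(* S j k is the measure multiplying a_k in the j-th form; for fixed j these are supported in D j. *)
definition ml_hermite_pade ::
    "nat \<Rightarrow> (nat \<Rightarrow> real set) \<Rightarrow> (nat \<Rightarrow> nat \<Rightarrow> csmeasure) \<Rightarrow> nat \<Rightarrow> (nat \<Rightarrow> complex poly) \<Rightarrow> bool"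
  where "ml_hermite_pade m D S n a \<longleftrightarrow>
     (\<exists>j\<in>{0..m}. a j \<noteq> 0) \<and>
     (\<forall>j\<in>{0..<m}. degree (a j) \<le> n - 1) \<and> degree (a m) \<le> n \<and>
     bigo_nontang (D 0) (ml_form m S a 0) (n + 1) \<and>
     (\<forall>j\<in>{1..<m}. bigo_nontang (D j) (ml_form m S a j) 1)"

definition multilevel_HP ::
    "nat \<Rightarrow> (nat \<Rightarrow> real set) \<Rightarrow> (nat \<Rightarrow> csmeasure) \<Rightarrow> nat \<Rightarrow> (nat \<Rightarrow> complex poly) \<Rightarrow> bool"
  where "multilevel_HP m \<Delta> \<sigma> n a \<longleftrightarrow>
     ml_hermite_pade m (\<lambda>j. \<Delta> (j + 1)) (\<lambda>j k. nik \<sigma> (j + 1) k) n a"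

definition multilevel_HP_rev ::
    "nat \<Rightarrow> (nat \<Rightarrow> real set) \<Rightarrow> (nat \<Rightarrow> csmeasure) \<Rightarrow> nat \<Rightarrow> (nat \<Rightarrow> complex poly) \<Rightarrow> bool"
  where "multilevel_HP_rev m \<Delta> \<sigma> n b \<longleftrightarrow>
     ml_hermite_pade m (\<lambda>j. \<Delta> (m - j)) (\<lambda>j k. nik \<sigma> (m - j) (m - k + 1)) n b"

(* Iterated integral, the first list element being the outermost integration variable; factors
   independent of the inner variables are pulled out of the inner integrals. *)
fun chain_kernel :: "csmeasure list \<Rightarrow> real \<Rightarrow> real \<Rightarrow> real"
  where
    "chain_kernel [] x y = 1 / (x - y)"
  | "chain_kernel (s # ss) x y = cs_integral s (\<lambda>t. chain_kernel ss t y / (x - t))"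

(* The measures \<sigma>_2, ..., \<sigma>_{m-1} are integrated out; the list is empty for m = 2. *)
definition cauchy_conv_kernel :: "nat \<Rightarrow> (nat \<Rightarrow> csmeasure) \<Rightarrow> real \<Rightarrow> real \<Rightarrow> real"
  where "cauchy_conv_kernel m \<sigma> = chain_kernel (map \<sigma> [2..<m])"

definition biorth_integrand ::
    "nat \<Rightarrow> (nat \<Rightarrow> csmeasure) \<Rightarrow> complex poly \<Rightarrow> complex poly \<Rightarrow> real \<Rightarrow> real \<Rightarrow> complex"
  where "biorth_integrand m \<sigma> q p x y =
     poly q (of_real x) * of_real (cauchy_conv_kernel m \<sigma> x y) * poly p (of_real y)"

end

(* The remainders satisfy A_j(z) = \<integral> A_(j+1)(x) d\<sigma>_(j+1)(x) / (z - x): the difference of both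
   sides is a polynomial that tends to 0 along the imaginary axis. Iterating from A_m = (-1)^m a_m
   gives A_1(x) = (-1)^m \<integral> K(x,y) a_m(y) d\<sigma>_m(y), and A_0 = O(1/z^(n+1)) says that A_1 is orthogonal to
   all polynomials of degree < n. The same argument for the reversed system, whose kernel is
   \<plusminus>K(y,x), gives the orthogonality for k < n and for k > n.

   For k = n one needs that the bilinear moment matrix of K is nondegenerate: if a real p of degree
   < N gives \<integral>\<integral> x^\<nu> K(x,y) p(y) = 0 for all \<nu> < N, then the N zeros on \<Delta>_1 forced by orthogonality
   propagate through \<Delta>_2, ..., \<Delta>_m until p itself has N zeros, so p = 0. Complex p are treated by
   real and imaginary parts.

   Integrability: all kernels have constant sign, and the total masses involved are moments of the
   product measures s_(j,m) and s_(m,j), since |q(x) p(y)| \<le> |q(x)|^2 + |p(y)|^2. *)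

theory Submission
  imports Defs "HOL-Computational_Algebra.Fundamental_Theorem_Algebra"
begin

section \<open>Measures of constant sign and Cauchy transforms\<close>

text \<open>Consecutive intervals may touch and intervals may be unbounded, so 1/(x - t) can be
  unbounded on \<open>\<Delta> j\<close> x \<open>\<Delta> (Suc j)\<close>; moreover, finiteness is
  assumed for the product measures, not for the kernel. It is therefore established first for
  nonnegative kernels with values in [0, infinity], on sets \<open>E j\<close> from which the
  touching points are removed; signs are restored afterwards. The imaginary axis suffices for all
  limits because it keeps distance |z| from the real line and so is non-tangential to every
  \<open>\<Delta> j\<close>. Zeros are counted as distinct points, so that partial fractions with
  simple poles suffice. Nondegeneracy acts twice on the diagonal: with N = n it forces
  \<open>a m\<close> and \<open>b m\<close> to have degree exactly n; then \<open>b m\<close> and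
  the polynomials of degree below n span all degrees up to n, so h_n = 0 would make
  \<open>a m\<close> orthogonal to all of them, against nondegeneracy with N = n + 1. The reversed
  system is the same locale for the generators reflected by i -> m + 1 - i.\<close>

lemma AE_supp:
  assumes "sets (mmod s) = sets borel"
  shows "AE x in mmod s. x \<in> supp s"
proof -
  obtain B :: "real set set" where B: "countable B" "topological_basis B"
    using ex_countable_basis by blast
  \<comment> \<open>The complement of the support is a union of possibly uncountably many null open
    sets; null members of a countable basis already cover it.\<close>
  have "AE x in mmod s. \<forall>b\<in>{b\<in>B. emeasure (mmod s) b = 0}. x \<notin> b"
  proof (subst AE_ball_countable)
    show "countable {b\<in>B. emeasure (mmod s) b = 0}"
      using B(1) by simp
    show "\<forall>b\<in>{b\<in>B. emeasure (mmod s) b = 0}. AE x in mmod s. x \<notin> b"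
    proof
      fix b assume b: "b \<in> {b\<in>B. emeasure (mmod s) b = 0}"
      then have "open b" using topological_basis_open[OF B(2)] by blast
      then have "b \<in> null_sets (mmod s)" using b assms by (simp add: null_sets_def)
      then show "AE x in mmod s. x \<notin> b" by (rule AE_not_in)
    qed
  qed
  then show ?thesis
  proof eventually_elim
    case (elim x)
    show ?case
      unfolding supp_def
    proof (safe, rule ccontr)
      fix U assume U: "open U" "x \<in> U" "\<not> 0 < emeasure (mmod s) U"
      then obtain b where b: "b \<in> B" "x \<in> b" "b \<subseteq> U"
        using B(2) topological_basisE by blast
      have "emeasure (mmod s) b \<le> emeasure (mmod s) U"
        using b(3) U(1) assms by (intro emeasure_mono) auto
      then show False using elim b U(3) by auto
    qed
  qed
qed

lemma closed_supp: "closed (supp s)"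
proof -
  have "- supp s = \<Union>{U. open U \<and> \<not> emeasure (mmod s) U > 0}"
    by (auto simp: supp_def)
  then show ?thesis
    unfolding closed_def by (auto intro: open_Union)
qed

text \<open>Supplies the contradiction in the zero count: measures in \<open>class_M\<close> have
  infinite support, so they cannot sit on finitely many zeros.\<close>

lemma supp_subset_finite:
  assumes "sets (mmod s) = sets borel" "finite F" "AE x in mmod s. x \<in> F"
  shows "supp s \<subseteq> F"
proof (rule ccontr)
  assume "\<not> supp s \<subseteq> F"
  then obtain x where x: "x \<in> supp s" "x \<notin> F" by blast
  have o: "open (- F)" using assms(2) by (simp add: finite_imp_closed open_Compl)
  then have "emeasure (mmod s) (- F) = 0"
    using AE_iff_null_sets[of "- F" "mmod s"] assms(1,3) by auto
  then show False using x o unfolding supp_def by auto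
qed

lemma class_M_sets [measurable_cong]: "s \<in> class_M D \<Longrightarrow> sets (mmod s) = sets borel"
  by (simp add: class_M_def)

lemma class_M_finite: assumes "s \<in> class_M D" shows "finite_measure (mmod s)"
proof (rule finite_measureI)
  have "integrable (mmod s) (\<lambda>x. x ^ 0)" using assms unfolding class_M_def by blast
  then show "emeasure (mmod s) (space (mmod s)) \<noteq> \<infinity>"
    by (auto simp: integrable_iff_bounded)
qed

lemma class_M_AE: "s \<in> class_M D \<Longrightarrow> AE x in mmod s. x \<in> D"
  using AE_supp[of s] by (auto simp: class_M_def elim!: eventually_mono)

lemma class_M_integrable_poly:
  fixes p :: "complex poly"
  assumes "s \<in> class_M D"
  shows "integrable (mmod s) (\<lambda>x. poly p (of_real x))"
proof -
  have "integrable (mmod s) (\<lambda>x. complex_of_real (x ^ i))" for i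
    using assms unfolding class_M_def by (intro integrable_of_real) blast
  then show ?thesis
    unfolding poly_altdef of_real_power by (intro Bochner_Integration.integrable_sum integrable_mult_right) auto
qed

section \<open>Cauchy integrals at points off the interval\<close>

lemma dist_outside:
  assumes "s \<in> class_M D" "z \<notin> complex_of_real ` D"
  obtains d where "d > 0" "AE t in mmod s. d \<le> norm (z - of_real t)"
proof (cases "Im z = 0")
  case False
  have "\<bar>Im z\<bar> \<le> norm (z - of_real t)" for t
    using abs_Im_le_cmod[of "z - of_real t"] by simp
  then show ?thesis using that[of "\<bar>Im z\<bar>"] False by auto
next
  case True
  then have z: "z = of_real (Re z)" by (simp add: complex_eq_iff)
  then have "Re z \<notin> supp s"
    using assms unfolding class_M_def by (metis (mono_tags, lifting) image_eqI mem_Collect_eq subsetD)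
  \<comment> \<open>\<open>D\<close> need not be closed, so a point outside may be a limit point of
    \<open>D\<close>; the positive distance is the one to the closed set
    \<open>supp s\<close>.\<close>
  then obtain d where d: "d > 0" "\<And>t. t \<in> supp s \<Longrightarrow> d \<le> dist (Re z) t"
    using separate_point_closed[OF closed_supp] by metis
  have "AE t in mmod s. d \<le> norm (z - of_real t)"
    using AE_supp[OF class_M_sets[OF assms(1)]]
  proof eventually_elim
    case (elim t)
    have "norm (z - of_real t) = dist (Re z) t"
      by (subst z) (simp add: dist_real_def del: of_real_diff add: of_real_diff[symmetric])
    then show ?case using d(2)[OF elim] by simp
  qed
  then show ?thesis using that d(1) by blast
qed

lemma dist_outside_real:
  assumes "s \<in> class_M D" "x \<notin> D"
  obtains d where "d > 0" "AE t in mmod s. d \<le> \<bar>x - t\<bar>"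
proof -
  have "complex_of_real x \<notin> of_real ` D" using assms(2) by auto
  then obtain d where d: "d > 0" "AE t in mmod s. d \<le> norm (complex_of_real x - of_real t)"
    by (rule dist_outside[OF assms(1)])
  have "norm (complex_of_real x - of_real t) = \<bar>x - t\<bar>" for t
    by (metis norm_of_real of_real_diff)
  then show ?thesis using that[OF d(1)] d(2) by simp
qed

lemma integrable_over_linear:
  fixes f :: "real \<Rightarrow> complex"
  assumes s: "s \<in> class_M D" and z: "z \<notin> complex_of_real ` D" and f: "integrable (mmod s) f"
  shows "integrable (mmod s) (\<lambda>x. f x / (z - of_real x))"
proof -
  note [measurable_cong] = class_M_sets[OF s]
  obtain d where d: "d > 0" "AE t in mmod s. d \<le> norm (z - of_real t)"
    using dist_outside[OF s z] .
  have [measurable]: "f \<in> borel_measurable (mmod s)" using f by auto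
  show ?thesis
  proof (rule Bochner_Integration.integrable_bound[OF integrable_mult_right[OF f, of "of_real (1/d)"]])
    show "(\<lambda>x. f x / (z - of_real x)) \<in> borel_measurable (mmod s)" by measurable
    show "AE x in mmod s. norm (f x / (z - of_real x)) \<le> norm (of_real (1 / d) * f x)"
      using d(2)
    proof eventually_elim
      case (elim x)
      have "norm (f x) / norm (z - of_real x) \<le> norm (f x) / d"
        using elim d(1) by (intro divide_left_mono mult_pos_pos) auto
      then show ?case using d(1) by (simp add: norm_divide norm_mult)
    qed
  qed
qed

lemma integrable_over_linear_real:
  fixes f :: "real \<Rightarrow> real"
  assumes s: "s \<in> class_M D" and z: "z \<notin> D" and f: "integrable (mmod s) f"
  shows "integrable (mmod s) (\<lambda>x. f x / (z - x))"
proof -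
  have "integrable (mmod s) (\<lambda>x. complex_of_real (f x) / (of_real z - of_real x))"
    using z f by (intro integrable_over_linear[OF s]) auto
  then have "integrable (mmod s) (\<lambda>x. Re (complex_of_real (f x) / (of_real z - of_real x)))"
    by (rule integrable_Re)
  then show ?thesis by (simp del: of_real_diff add: of_real_diff[symmetric])
qed

lemma cauchy_of_real: "cauchy s (of_real x :: complex) = of_real (cauchy s x)"
proof -
  have "(\<lambda>t. 1 / (complex_of_real x - complex_of_real t)) = (\<lambda>t. complex_of_real (1 / (x - t)))"
    by (simp add: fun_eq_iff)
  then show ?thesis
    by (simp add: cauchy_def cs_integral_def scaleR_conv_of_real del: of_real_divide of_real_diff)
qed

lemma cs_integral_add:
  "integrable (mmod s) f \<Longrightarrow> integrable (mmod s) g \<Longrightarrow>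
    cs_integral s (\<lambda>x. f x + g x) = cs_integral s f + cs_integral s g"
  by (simp add: cs_integral_def scaleR_add_right)

lemma cs_integral_sum:
  "(\<And>i. i \<in> I \<Longrightarrow> integrable (mmod s) (f i)) \<Longrightarrow>
    cs_integral s (\<lambda>x. \<Sum>i\<in>I. f i x) = (\<Sum>i\<in>I. cs_integral s (f i))"
  by (simp add: cs_integral_def scaleR_sum_right)

lemma cs_integral_mult_left:
  fixes c :: "'a::{real_normed_field, banach, second_countable_topology}"
  shows "cs_integral s (\<lambda>x. c * f x) = c * cs_integral s f"
  by (simp add: cs_integral_def)

lemma cs_integral_mult_right:
  fixes c :: "'a::{real_normed_field, banach, second_countable_topology}"
  shows "cs_integral s (\<lambda>x. f x * c) = cs_integral s f * c"
  by (simp add: cs_integral_def)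

lemma cs_integral_of_real:
  "cs_integral s (\<lambda>x. complex_of_real (f x)) = of_real (cs_integral s f)"
  by (simp add: cs_integral_def scaleR_conv_of_real)

lemma cs_integral_Re:
  "integrable (mmod s) f \<Longrightarrow> cs_integral s (\<lambda>x. Re (f x)) = Re (cs_integral s f)"
  by (simp add: cs_integral_def)

lemma cs_integral_cong_AE:
  assumes "AE x in mmod s. f x = g x" "f \<in> borel_measurable (mmod s)" "g \<in> borel_measurable (mmod s)"
  shows "cs_integral s f = cs_integral s g"
  using integral_cong_AE[OF assms(2,3,1)] by (simp add: cs_integral_def)

text \<open>In \<open>p(z) (s^)(z) = R(z) + \<integral> p(x)/(z - x) ds(x)\<close> the polynomial is
  \<open>R(z) = \<integral> (p(z) - p(x))/(z - x) ds(x)\<close>.\<close>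

lemma poly_mult_cauchy:
  fixes p :: "complex poly"
  assumes s: "s \<in> class_M D"
  shows "\<exists>R. \<forall>z. z \<notin> complex_of_real ` D \<longrightarrow>
    poly p z * cauchy s z = poly R z + cs_integral s (\<lambda>x. poly p (of_real x) / (z - of_real x))"
proof (induction p)
  case 0
  show ?case by (rule exI[of _ 0]) (simp add: cs_integral_def)
next
  case (pCons c q)
  obtain R where R: "\<And>z. z \<notin> complex_of_real ` D \<Longrightarrow>
    poly q z * cauchy s z = poly R z + cs_integral s (\<lambda>x. poly q (of_real x) / (z - of_real x))"
    using pCons.IH by blast
  \<comment> \<open>The new constant coefficient of R, produced by x q(x)/(z - x) = z q(x)/(z - x) -
    q(x).\<close>
  define k where "k = cs_integral s (\<lambda>x. poly q (of_real x))"
  show ?case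
  proof (intro exI[of _ "pCons k R"] allI impI)
    fix z assume z: "z \<notin> complex_of_real ` D"
    note int = class_M_integrable_poly[OF s] integrable_over_linear[OF s z class_M_integrable_poly[OF s]]
    obtain d where d: "d > 0" "AE t in mmod s. d \<le> norm (z - of_real t)"
      using dist_outside[OF s z] .
    have [measurable]: "sets (mmod s) = sets borel" using s by (rule class_M_sets)
    note [measurable_cong] = this
    have i1: "integrable (mmod s) (\<lambda>x. 1 / (z - complex_of_real x))"
      using int(2)[of 1] by simp
    have "cs_integral s (\<lambda>x. poly (pCons c q) (of_real x) / (z - of_real x)) + k
       = cs_integral s (\<lambda>x. poly (pCons c q) (of_real x) / (z - of_real x) + poly q (of_real x))"
      unfolding k_def by (intro cs_integral_add[symmetric] int)
    also have "\<dots> = cs_integral s (\<lambda>x. c * (1 / (z - of_real x)) + z * (poly q (of_real x) / (z - of_real x)))"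
    proof (rule cs_integral_cong_AE)
      show "AE x in mmod s. poly (pCons c q) (of_real x) / (z - of_real x) + poly q (of_real x)
         = c * (1 / (z - of_real x)) + z * (poly q (of_real x) / (z - of_real x))"
        using d(2)
      proof eventually_elim
        case (elim x)
        then have "z - of_real x \<noteq> 0" using d(1) by auto
        moreover define w where "w = z - complex_of_real x"
        ultimately have "w \<noteq> 0" "z = w + of_real x" by simp_all
        then show ?case by (simp add: field_simps)
      qed
    qed (use int i1 in \<open>auto intro!: borel_measurable_add borel_measurable_times dest: borel_measurable_integrable\<close>)
    also have "\<dots> = c * cauchy s z + z * cs_integral s (\<lambda>x. poly q (of_real x) / (z - of_real x))"
      unfolding cauchy_def
      by (simp only: cs_integral_add[OF integrable_mult_right[OF i1] integrable_mult_right[OF int(2)]]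
          cs_integral_mult_left)
    finally show "poly (pCons c q) z * cauchy s z =
        poly (pCons k R) z + cs_integral s (\<lambda>x. poly (pCons c q) (of_real x) / (z - of_real x))"
      using R[OF z] by (simp add: algebra_simps)
  qed
qed

section \<open>Behaviour at infinity along the imaginary axis\<close>

lemma cauchy_integral_tendsto_0:
  fixes f :: "real \<Rightarrow> complex"
  assumes s: "s \<in> class_M D" and f: "integrable (mmod s) f"
  shows "((\<lambda>y. cs_integral s (\<lambda>x. f x / (\<i> * of_real y - of_real x))) \<longlongrightarrow> 0) at_top"
proof (rule Lim_null_comparison)
  have bd: "((\<lambda>y::real. c / y) \<longlongrightarrow> 0) at_top" for c :: real
    by (intro tendsto_divide_0[OF tendsto_const] filterlim_at_top_imp_at_infinity filterlim_ident)
  show "((\<lambda>y::real. \<bar>msign s\<bar> * (\<integral>x. norm (f x) \<partial>mmod s) / y) \<longlongrightarrow> 0) at_top" by (rule bd)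
  show "\<forall>\<^sub>F y in at_top. norm (cs_integral s (\<lambda>x. f x / (\<i> * of_real y - of_real x)))
     \<le> \<bar>msign s\<bar> * (\<integral>x. norm (f x) \<partial>mmod s) / y"
    using eventually_gt_at_top[of "0::real"]
  proof eventually_elim
    case (elim y)
    have z: "\<i> * of_real y \<notin> complex_of_real ` D"
      using elim by (auto simp: complex_eq_iff)
    \<comment> \<open>Uniform in real x, so the bound also covers unbounded supports.\<close>
    have n: "y \<le> norm (\<i> * of_real y - complex_of_real x)" for x
      using abs_Im_le_cmod[of "\<i> * of_real y - complex_of_real x"] elim by simp
    have "norm (\<integral>x. f x / (\<i> * of_real y - of_real x) \<partial>mmod s)
        \<le> (\<integral>x. norm (f x / (\<i> * of_real y - of_real x)) \<partial>mmod s)"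
      by (rule integral_norm_bound)
    also have "\<dots> \<le> (\<integral>x. norm (f x) / y \<partial>mmod s)"
    proof (rule integral_mono)
      show "integrable (mmod s) (\<lambda>x. norm (f x / (\<i> * of_real y - of_real x)))"
        by (intro integrable_norm integrable_over_linear[OF s z f])
      show "norm (f x / (\<i> * of_real y - of_real x)) \<le> norm (f x) / y" for x
        unfolding norm_divide using n[of x] elim by (intro divide_left_mono mult_pos_pos) auto
    qed (use f in auto)
    finally show ?case
      by (simp add: cs_integral_def mult_left_mono times_divide_eq_right[symmetric] del: times_divide_eq_right)
  qed
qed

lemma poly_tendsto_0_imp_0:
  fixes P :: "complex poly"
  assumes "((\<lambda>y. poly P (\<i> * of_real y)) \<longlongrightarrow> 0) at_top"
  shows "P = 0"
proof -
  obtain c q where P: "P = pCons c q" by (cases P) auto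
  have q: "q = 0"
  proof (rule ccontr)
    assume "q \<noteq> 0"
    then obtain r where r: "\<And>z. r \<le> norm z \<Longrightarrow> 1 \<le> norm (poly (pCons c q) z)"
      using poly_infinity by blast
    have "\<forall>\<^sub>F y in at_top. norm (poly P (\<i> * of_real y)) < 1"
      using tendstoD[OF assms, of 1] by simp
    moreover have "\<forall>\<^sub>F y in at_top. 1 \<le> norm (poly P (\<i> * of_real y))"
      using eventually_ge_at_top[of "\<bar>r\<bar>"]
      by eventually_elim (use r P in \<open>auto simp: norm_mult\<close>)
    ultimately have "\<forall>\<^sub>F y::real in at_top. False" by eventually_elim simp
    then show False by simp
  qed
  then have "((\<lambda>y::real. c) \<longlongrightarrow> 0) at_top" using assms P by simp
  then have "c = 0" by (simp add: tendsto_const_iff)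
  then show ?thesis using P q by simp
qed

lemma bigo_nontang_tendsto_0:
  assumes "bigo_nontang D f N" "D \<noteq> {}" "k < N"
  shows "((\<lambda>y. (\<i> * of_real y) ^ k * f (\<i> * of_real y)) \<longlongrightarrow> 0) at_top"
proof -
  \<comment> \<open>The choice \<delta> = 1 is possible since iy has distance exactly |iy| from the
    real line. Nonemptiness of \<open>D\<close> matters: \<open>infdist\<close> to the empty set is
    0, and the region would then miss the axis.\<close>
  let ?F = "inf at_infinity (principal {z. infdist z (complex_of_real ` D) \<ge> 1 * norm z})"
  have "f \<in> O[?F](\<lambda>z. 1 / z ^ N)"
    using assms(1) unfolding bigo_nontang_def by (metis zero_less_one)
  then obtain c where c: "\<forall>\<^sub>F z in ?F. norm (f z) \<le> c * norm (1 / z ^ N)"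
    unfolding bigo_def by auto
  have lim: "filterlim (\<lambda>y. \<i> * complex_of_real y) ?F at_top"
    unfolding filterlim_inf filterlim_principal
  proof
    show "filterlim (\<lambda>y. \<i> * complex_of_real y) at_infinity at_top"
      unfolding filterlim_at_infinity[OF order_refl]
    proof (intro allI impI)
      fix r :: real
      show "\<forall>\<^sub>F x in at_top. r \<le> norm (\<i> * complex_of_real x)"
        using eventually_ge_at_top[of "\<bar>r\<bar>"] by eventually_elim (simp add: norm_mult)
    qed
    show "\<forall>\<^sub>F y in at_top. \<i> * complex_of_real y \<in> {z. infdist z (complex_of_real ` D) \<ge> 1 * norm z}"
      using eventually_gt_at_top[of 0]
    proof eventually_elim
      case (elim y)
      have "y \<le> infdist (\<i> * of_real y) (complex_of_real ` D)"
        unfolding infdist_def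
      proof (simp add: assms(2), rule cINF_greatest)
        fix w assume "w \<in> complex_of_real ` D"
        then obtain x where w: "w = of_real x" by auto
        show "y \<le> dist (\<i> * of_real y) w"
          using abs_Im_le_cmod[of "\<i> * of_real y - complex_of_real x"] elim by (simp add: dist_norm w)
      qed (use assms(2) in auto)
      then show ?case using elim by (simp add: norm_mult)
    qed
  qed
  have ev: "\<forall>\<^sub>F y in at_top. norm (f (\<i> * of_real y)) \<le> c * norm (1 / (\<i> * complex_of_real y) ^ N)"
    using eventually_compose_filterlim[OF c lim] .
  show ?thesis
  proof (rule Lim_null_comparison)
    show "((\<lambda>y::real. \<bar>c\<bar> / y) \<longlongrightarrow> 0) at_top"
      by (intro tendsto_divide_0[OF tendsto_const] filterlim_at_top_imp_at_infinity filterlim_ident)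
    show "\<forall>\<^sub>F y in at_top. norm ((\<i> * of_real y) ^ k * f (\<i> * of_real y)) \<le> \<bar>c\<bar> / y"
      using ev eventually_ge_at_top[of 1]
    proof eventually_elim
      case (elim y)
      have "norm ((\<i> * of_real y) ^ k * f (\<i> * of_real y)) \<le> y ^ k * (c * (1 / y ^ N))"
        unfolding norm_mult norm_power using elim
        by (intro mult_mono) (simp_all add: norm_mult norm_power norm_divide)
      also have "\<dots> \<le> y ^ k * (\<bar>c\<bar> * (1 / y ^ Suc k))"
      proof (intro mult_left_mono mult_mono divide_left_mono)
        show "y ^ Suc k \<le> y ^ N" using elim assms(3) by (intro power_increasing) auto
      qed (use elim in auto)
      also have "\<dots> = \<bar>c\<bar> / y" using elim by simp
      finally show ?case .
    qed
  qed
qed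

text \<open>Moments are peeled off one at a time by iy H_\<mu>(y) = c_\<mu> + H_(\<mu>+1)(y), where
  H_\<mu> is the Cauchy integral of x^\<mu> f and c_\<mu> the moment. Once the earlier moments
  vanish, (iy)^(\<nu>+1) H_0 = c_\<nu> + H_(\<nu>+1), and both H-terms tend to 0. The moment of
  order \<nu> thus uses the power \<nu> + 1, which is why \<open>lim\<close> goes up to n and the
  conclusion only to \<nu> < n.\<close>

lemma moments_vanish:
  fixes f :: "real \<Rightarrow> complex"
  assumes s: "s \<in> class_M D"
    and int: "\<And>\<nu>. integrable (mmod s) (\<lambda>x. of_real x ^ \<nu> * f x)"
    and lim: "\<And>k. k \<le> n \<Longrightarrow> ((\<lambda>y. (\<i> * of_real y) ^ k *
       cs_integral s (\<lambda>x. f x / (\<i> * of_real y - of_real x))) \<longlongrightarrow> 0) at_top"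
    and "\<nu> < n"
  shows "cs_integral s (\<lambda>x. of_real x ^ \<nu> * f x) = 0"
  using \<open>\<nu> < n\<close>
proof (induction \<nu> rule: less_induct)
  case (less \<nu>)
  note [measurable_cong] = class_M_sets[OF s]
  have fm[measurable]: "f \<in> borel_measurable borel" using int[of 0] by (auto dest: borel_measurable_integrable)
  define H where "H \<mu> y = cs_integral s (\<lambda>x. of_real x ^ \<mu> * f x / (\<i> * of_real y - of_real x))" for \<mu> and y :: real
  have step: "\<i> * of_real y * H \<mu> y = cs_integral s (\<lambda>x. of_real x ^ \<mu> * f x) + H (Suc \<mu>) y" if "y > 0" for \<mu> y
  proof -
    have z: "\<i> * of_real y \<notin> complex_of_real ` D"
      using that by (auto simp: complex_eq_iff)
    have nz: "\<i> * of_real y - complex_of_real x \<noteq> 0" for x using that by (auto simp: complex_eq_iff)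
    have "cs_integral s (\<lambda>x. of_real x ^ \<mu> * f x) + H (Suc \<mu>) y =
      cs_integral s (\<lambda>x. of_real x ^ \<mu> * f x + of_real x ^ Suc \<mu> * f x / (\<i> * of_real y - of_real x))"
      unfolding H_def by (intro cs_integral_add[symmetric] int integrable_over_linear[OF s z])
    also have "\<dots> = cs_integral s (\<lambda>x. \<i> * of_real y * (of_real x ^ \<mu> * f x / (\<i> * of_real y - of_real x)))"
      using nz by (intro arg_cong[of _ _ "cs_integral s"] ext) (simp add: field_simps)
    finally show ?thesis unfolding H_def cs_integral_mult_left by simp
  qed
  have pw: "H \<mu> y = (\<i> * of_real y) ^ \<mu> * H 0 y" if "\<mu> \<le> \<nu>" "y > 0" for \<mu> y
    using that(1)
  proof (induction \<mu>)
    case (Suc \<mu>)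
    then have "cs_integral s (\<lambda>x. of_real x ^ \<mu> * f x) = 0" using less.IH less.prems by auto
    then show ?case using step[OF that(2), of \<mu>] Suc by (auto simp: mult.assoc)
  qed simp
  have "\<forall>\<^sub>F y in at_top. (\<i> * of_real y) ^ Suc \<nu> * H 0 y - H (Suc \<nu>) y = cs_integral s (\<lambda>x. of_real x ^ \<nu> * f x)"
    using eventually_gt_at_top[of 0]
    by eventually_elim (use step[of _ \<nu>] pw[of \<nu>] in \<open>simp add: algebra_simps\<close>)
  moreover have "((\<lambda>y. (\<i> * of_real y) ^ Suc \<nu> * H 0 y - H (Suc \<nu>) y) \<longlongrightarrow> 0 - 0) at_top"
    unfolding H_def using less.prems
    by (intro tendsto_diff cauchy_integral_tendsto_0[OF s int]) (use lim[of "Suc \<nu>"] in auto)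
  ultimately have "((\<lambda>y::real. cs_integral s (\<lambda>x. of_real x ^ \<nu> * f x)) \<longlongrightarrow> 0) at_top"
    by (simp add: tendsto_cong)
  then show ?case by (simp add: tendsto_const_iff)
qed

section \<open>Chain kernels\<close>

text \<open>With values in \<open>[0, \<infinity>]\<close> Tonelli's theorem applies without integrability conditions.\<close>

fun abs_kernel :: "real measure list \<Rightarrow> real \<Rightarrow> real \<Rightarrow> ennreal"
  where
    "abs_kernel [] x y = ennreal (1 / \<bar>x - y\<bar>)"
  | "abs_kernel (M # Ms) x y = (\<integral>\<^sup>+t. ennreal (1 / \<bar>x - t\<bar>) * abs_kernel Ms t y \<partial>M)"

text \<open>For the measures |\<sigma>_(j+1)|, ..., |\<sigma>_k| this is the density of |s_(j,k)|
  with respect to |\<sigma>_j|, see \<open>mmod_nik\<close>.\<close>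

fun abs_chain :: "real measure list \<Rightarrow> real \<Rightarrow> ennreal"
  where
    "abs_chain [] x = 1"
  | "abs_chain (M # Ms) x = (\<integral>\<^sup>+t. ennreal (1 / \<bar>x - t\<bar>) * abs_chain Ms t \<partial>M)"

definition borel_finite :: "real measure \<Rightarrow> bool" where
  "borel_finite M \<longleftrightarrow> finite_measure M \<and> sets M = sets borel"

lemma borel_finite_sigma: "borel_finite M \<Longrightarrow> sigma_finite_measure M"
  by (simp add: borel_finite_def finite_measure_def)

lemma borel_finite_sets: "borel_finite M \<Longrightarrow> sets M = sets borel"
  by (simp add: borel_finite_def)

lemma borel_finite_pair: "borel_finite M \<Longrightarrow> borel_finite N \<Longrightarrow> pair_sigma_finite M N"
  by (simp add: pair_sigma_finite_def borel_finite_sigma)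

lemma borel_finite_pair_sets:
  "borel_finite M \<Longrightarrow> borel_finite N \<Longrightarrow> sets (M \<Otimes>\<^sub>M N) = sets (borel \<Otimes>\<^sub>M borel)"
  by (intro sets_pair_measure_cong borel_finite_sets)

lemma measurable_nn_integral_borel:
  assumes "borel_finite M" "case_prod f \<in> borel_measurable (N \<Otimes>\<^sub>M borel)"
  shows "(\<lambda>x. \<integral>\<^sup>+t. f x t \<partial>M) \<in> borel_measurable N"
proof (rule sigma_finite_measure.borel_measurable_nn_integral[OF borel_finite_sigma[OF assms(1)]])
  have "sets (N \<Otimes>\<^sub>M M) = sets (N \<Otimes>\<^sub>M borel)"
    by (intro sets_pair_measure_cong borel_finite_sets assms refl)
  then show "case_prod f \<in> borel_measurable (N \<Otimes>\<^sub>M M)"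
    using assms(2) by (simp cong: measurable_cong_sets)
qed

lemma measurable_integral_borel:
  fixes f :: "'b \<Rightarrow> real \<Rightarrow> 'a::{banach, second_countable_topology}"
  assumes "borel_finite M" "case_prod f \<in> borel_measurable (N \<Otimes>\<^sub>M borel)"
  shows "(\<lambda>x. \<integral>t. f x t \<partial>M) \<in> borel_measurable N"
proof (rule sigma_finite_measure.borel_measurable_lebesgue_integral[OF borel_finite_sigma[OF assms(1)]])
  have "sets (N \<Otimes>\<^sub>M M) = sets (N \<Otimes>\<^sub>M borel)"
    by (intro sets_pair_measure_cong borel_finite_sets assms refl)
  then show "case_prod f \<in> borel_measurable (N \<Otimes>\<^sub>M M)"
    using assms(2) by (simp cong: measurable_cong_sets)
qed

lemma abs_kernel_measurable:
  "list_all borel_finite Ms \<Longrightarrow> case_prod (abs_kernel Ms) \<in> borel_measurable (borel \<Otimes>\<^sub>M borel)"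
proof (induction Ms)
  case Nil
  have "case_prod (abs_kernel []) = (\<lambda>p. ennreal (1 / \<bar>fst p - snd p\<bar>))" by (simp add: fun_eq_iff)
  then show ?case by simp
next
  case (Cons M Ms)
  have *: "case_prod (abs_kernel Ms) \<in> borel_measurable (borel \<Otimes>\<^sub>M borel)" using Cons by simp
  have "(\<lambda>q. abs_kernel Ms (snd q) (snd (fst q))) \<in> borel_measurable ((borel \<Otimes>\<^sub>M borel) \<Otimes>\<^sub>M borel)"
    by (rule measurable_compose[OF _ *, of "\<lambda>q. (snd q, snd (fst q))", simplified]) measurable
  then have [measurable]: "(\<lambda>q. abs_kernel Ms (snd q) (snd (fst q))) \<in> borel_measurable ((borel \<Otimes>\<^sub>M borel) \<Otimes>\<^sub>M borel)" .
  have "(\<lambda>p. \<integral>\<^sup>+t. ennreal (1 / \<bar>fst p - t\<bar>) * abs_kernel Ms t (snd p) \<partial>M)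
    \<in> borel_measurable (borel \<Otimes>\<^sub>M borel)"
    using Cons.prems by (intro measurable_nn_integral_borel) (simp_all add: case_prod_beta')
  then show ?case by (simp add: case_prod_beta')
qed

lemma abs_kernel_measurable2:
  assumes "list_all borel_finite Ms" "f \<in> borel_measurable N" "g \<in> borel_measurable N"
  shows "(\<lambda>x. abs_kernel Ms (f x) (g x)) \<in> borel_measurable N"
  using measurable_compose[OF measurable_Pair[OF assms(2,3)] abs_kernel_measurable[OF assms(1)]] by simp

lemma abs_chain_measurable: "list_all borel_finite Ms \<Longrightarrow> abs_chain Ms \<in> borel_measurable borel"
proof (induction Ms)
  case Nil
  have "abs_chain [] = (\<lambda>x. 1)" by (simp add: fun_eq_iff)
  then show ?case by simp
next
  case (Cons M Ms)
  have [measurable]: "abs_chain Ms \<in> borel_measurable borel" using Cons by simp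
  have "(\<lambda>x. \<integral>\<^sup>+t. ennreal (1 / \<bar>x - t\<bar>) * abs_chain Ms t \<partial>M) \<in> borel_measurable borel"
    using Cons.prems by (intro measurable_nn_integral_borel) auto
  then show ?case by (simp add: fun_eq_iff cong: measurable_cong)
qed

lemma tonelli:
  assumes "borel_finite M" "borel_finite N" "case_prod f \<in> borel_measurable (borel \<Otimes>\<^sub>M borel)"
  shows "(\<integral>\<^sup>+x. \<integral>\<^sup>+y. f x y \<partial>N \<partial>M) = (\<integral>\<^sup>+y. \<integral>\<^sup>+x. f x y \<partial>M \<partial>N)"
proof -
  have "case_prod f \<in> borel_measurable (M \<Otimes>\<^sub>M N)"
    using assms(3) measurable_cong_sets[OF borel_finite_pair_sets[OF assms(1,2)] refl] by blast
  then show ?thesis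
    using pair_sigma_finite.Fubini'[OF borel_finite_pair[OF assms(1,2)]] by (metis)
qed

text \<open>The recursion exposes the left end of the list; Tonelli exposes the right end, which is
  needed to reverse the list and to bound the factor next to y.\<close>

lemma abs_kernel_snoc:
  assumes "list_all borel_finite (Ms @ [M])"
  shows "abs_kernel (Ms @ [M]) x y = (\<integral>\<^sup>+t. abs_kernel Ms x t * ennreal (1 / \<bar>t - y\<bar>) \<partial>M)"
  using assms
proof (induction Ms arbitrary: x)
  case (Cons N Ms)
  have M: "borel_finite M" "borel_finite N" "list_all borel_finite Ms" using Cons.prems by auto
  note [measurable] = abs_kernel_measurable2[OF M(3)]
  note [measurable_cong] = borel_finite_sets[OF M(1)] borel_finite_sets[OF M(2)]
  have "abs_kernel ((N # Ms) @ [M]) x y =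
     (\<integral>\<^sup>+s. \<integral>\<^sup>+t. ennreal (1 / \<bar>x - s\<bar>) * (abs_kernel Ms s t * ennreal (1 / \<bar>t - y\<bar>)) \<partial>M \<partial>N)"
    using Cons by (simp add: nn_integral_cmult)
  also have "\<dots> = (\<integral>\<^sup>+t. \<integral>\<^sup>+s. ennreal (1 / \<bar>x - s\<bar>) * (abs_kernel Ms s t * ennreal (1 / \<bar>t - y\<bar>)) \<partial>N \<partial>M)"
    by (rule tonelli[OF M(2,1)]) measurable
  also have "\<dots> = (\<integral>\<^sup>+t. abs_kernel (N # Ms) x t * ennreal (1 / \<bar>t - y\<bar>) \<partial>M)"
    by (simp add: nn_integral_multc mult.assoc[symmetric])
  finally show ?case .
qed (simp add: mult.commute)

text \<open>Through this identity double integrals of the kernel become moments of the product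
  measures.\<close>

lemma abs_chain_snoc:
  assumes "list_all borel_finite (Ms @ [M])"
  shows "abs_chain (Ms @ [M]) x = (\<integral>\<^sup>+y. abs_kernel Ms x y \<partial>M)"
  using assms
proof (induction Ms arbitrary: x)
  case (Cons N Ms)
  have M: "borel_finite M" "borel_finite N" "list_all borel_finite Ms" using Cons.prems by auto
  note [measurable] = abs_kernel_measurable2[OF M(3)]
  note [measurable_cong] = borel_finite_sets[OF M(1)] borel_finite_sets[OF M(2)]
  have "abs_chain ((N # Ms) @ [M]) x = (\<integral>\<^sup>+s. \<integral>\<^sup>+t. ennreal (1 / \<bar>x - s\<bar>) * abs_kernel Ms s t \<partial>M \<partial>N)"
    using Cons by (simp add: nn_integral_cmult)
  also have "\<dots> = (\<integral>\<^sup>+t. \<integral>\<^sup>+s. ennreal (1 / \<bar>x - s\<bar>) * abs_kernel Ms s t \<partial>N \<partial>M)"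
    by (rule tonelli[OF M(2,1)]) measurable
  finally show ?case by simp
next
  case Nil
  have "(\<lambda>y. abs_kernel [] x y) = (\<lambda>t. ennreal (1 / \<bar>x - t\<bar>))" by (simp add: fun_eq_iff)
  then show ?case by simp
qed

lemma abs_kernel_rev:
  "list_all borel_finite Ms \<Longrightarrow> abs_kernel (rev Ms) y x = abs_kernel Ms x y"
proof (induction Ms arbitrary: x)
  case (Cons M Ms)
  have "list_all borel_finite (rev Ms @ [M])" using Cons.prems by (simp add: list_all_iff)
  then show ?case
    using Cons by (simp add: abs_kernel_snoc mult.commute abs_minus_commute)
qed (simp add: abs_minus_commute)

section \<open>Signed kernels and Fubini\<close>

lemma chain_kernel_measurable:
  "list_all (\<lambda>s. borel_finite (mmod s)) ss \<Longrightarrow>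
    case_prod (chain_kernel ss) \<in> borel_measurable (borel \<Otimes>\<^sub>M borel)"
proof (induction ss)
  case Nil
  have "case_prod (chain_kernel []) = (\<lambda>p. 1 / (fst p - snd p))" by (simp add: fun_eq_iff)
  then show ?case by simp
next
  case (Cons s ss)
  have *: "case_prod (chain_kernel ss) \<in> borel_measurable (borel \<Otimes>\<^sub>M borel)" using Cons by simp
  have "(\<lambda>q. chain_kernel ss (snd q) (snd (fst q))) \<in> borel_measurable ((borel \<Otimes>\<^sub>M borel) \<Otimes>\<^sub>M borel)"
    by (rule measurable_compose[OF _ *, of "\<lambda>q. (snd q, snd (fst q))", simplified]) measurable
  then have [measurable]: "(\<lambda>q. chain_kernel ss (snd q) (snd (fst q))) \<in> borel_measurable ((borel \<Otimes>\<^sub>M borel) \<Otimes>\<^sub>M borel)" .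
  have "(\<lambda>p. \<integral>t. chain_kernel ss t (snd p) / (fst p - t) \<partial>mmod s)
    \<in> borel_measurable (borel \<Otimes>\<^sub>M borel)"
    using Cons.prems by (intro measurable_integral_borel) (simp_all add: case_prod_beta')
  then show ?case by (simp add: case_prod_beta' cs_integral_def)
qed

lemma chain_kernel_measurable2:
  assumes "list_all (\<lambda>s. borel_finite (mmod s)) ss" "f \<in> borel_measurable N" "g \<in> borel_measurable N"
  shows "(\<lambda>x. chain_kernel ss (f x) (g x)) \<in> borel_measurable N"
  using measurable_compose[OF measurable_Pair[OF assms(2,3)] chain_kernel_measurable[OF assms(1)]] by simp

lemma class_M_borel_finite: "s \<in> class_M D \<Longrightarrow> borel_finite (mmod s)"
  by (simp add: borel_finite_def class_M_finite class_M_sets)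

lemma cs_integral_swap:
  fixes f :: "real \<Rightarrow> real \<Rightarrow> complex"
  assumes "borel_finite (mmod s)" "borel_finite (mmod r)"
    and int: "integrable (mmod s \<Otimes>\<^sub>M mmod r) (\<lambda>(x, y). f x y)"
  shows "cs_integral s (\<lambda>x. cs_integral r (\<lambda>y. f x y)) = cs_integral r (\<lambda>y. cs_integral s (\<lambda>x. f x y))"
  using pair_sigma_finite.Fubini_integral[OF borel_finite_pair[OF assms(1,2)] int]
  by (simp add: cs_integral_def mult.left_commute)

lemma integrable_pair_bounded:
  fixes f :: "real \<times> real \<Rightarrow> complex" and g :: "real \<Rightarrow> complex"
  assumes MN: "borel_finite M" "borel_finite N" and f: "integrable (M \<Otimes>\<^sub>M N) f"
    and [measurable]: "g \<in> borel_measurable borel" and bd: "AE x in M. norm (g x) \<le> B"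
  shows "integrable (M \<Otimes>\<^sub>M N) (\<lambda>p. g (fst p) * f p)"
proof -
  note [measurable_cong] = borel_finite_sets[OF MN(1)] borel_finite_sets[OF MN(2)]
  have [measurable]: "f \<in> borel_measurable (M \<Otimes>\<^sub>M N)" using f by auto
  show ?thesis
  proof (rule Bochner_Integration.integrable_bound[OF integrable_mult_right[OF f, of "of_real B"]])
    show "(\<lambda>p. g (fst p) * f p) \<in> borel_measurable (M \<Otimes>\<^sub>M N)" by measurable
    have "AE p in M \<Otimes>\<^sub>M N. norm (g (fst p)) \<le> B"
      using bd by (intro pair_sigma_finite.AE_pair_measure[OF borel_finite_pair[OF MN]]) auto
    then show "AE p in M \<Otimes>\<^sub>M N. norm (g (fst p) * f p) \<le> norm (of_real B * f p)"
      by eventually_elim (auto simp: norm_mult intro!: mult_right_mono)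
  qed
qed

section \<open>Nikishin systems\<close>

lemma is_interval_diff:
  fixes A B :: "real set"
  assumes "is_interval A" "is_interval B" "infinite B" and AB: "A \<inter> B = {} \<or> (\<exists>x. A \<inter> B = {x})"
  shows "is_interval (A - B)"
  unfolding is_interval_1
proof (intro ballI allI impI)
  fix a b x assume ab: "a \<in> A - B" "b \<in> A - B" and "a \<le> x \<and> x \<le> b"
  then have x: "a \<le> x" "x \<le> b" by auto
  have xA: "x \<in> A" using assms(1) ab x unfolding is_interval_1 by blast
  have "x \<notin> B"
  proof
    assume xB: "x \<in> B"
    with xA have "x \<in> A \<inter> B" by simp
    then have only: "A \<inter> B = {x}" using AB by (metis empty_iff singletonD)
    have "\<not> B \<subseteq> {x}" using assms(3) finite_subset by blast
    then obtain c where c: "c \<in> B" "c \<noteq> x" by blast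
    \<comment> \<open>If the common point x lay strictly between a and b, then e, on the same side
      of x as c but not beyond b (or a), would be a second common point of A and B.\<close>
    define e where "e = (if x < c then min b c else max a c)"
    have "e \<in> A" using assms(1) ab xA x c unfolding is_interval_1 e_def
      by (smt (verit, best) DiffD1 max_def min_def)
    moreover have "e \<in> B" using assms(2) xB ab x c unfolding is_interval_1 e_def
      by (smt (verit, best) max_def min_def)
    moreover have "e \<noteq> x" using ab xB x c unfolding e_def by (auto simp: min_def max_def)
    ultimately show False using only by blast
  qed
  then show "x \<in> A - B" using xA by blast
qed

text \<open>One of two disjoint intervals lies entirely to the left of the other. This is the source
  of the constant sign of all kernels.\<close>

lemma disjoint_intervals_sign:
  fixes A B :: "real set"
  assumes "is_interval A" "is_interval B" "A \<inter> B = {}"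
  shows "\<exists>c\<in>{1, -1::real}. \<forall>x\<in>A. \<forall>t\<in>B. 1 / (x - t) = c / \<bar>x - t\<bar> \<and> x \<noteq> t"
proof -
  have "(\<forall>x\<in>A. \<forall>t\<in>B. x < t) \<or> (\<forall>x\<in>A. \<forall>t\<in>B. t < x)"
  proof (rule ccontr)
    assume "\<not> ?thesis"
    then obtain a b a' b' where *: "a \<in> A" "b \<in> B" "a' \<in> A" "b' \<in> B" "a \<le> b" "b' \<le> a'"
      by (meson linorder_not_less)
    show False
    proof (cases "a \<le> b'")
      case True
      then have "b' \<in> A" using assms(1) * unfolding is_interval_1 by blast
      then show False using * assms(3) by blast
    next
      case False
      then have "a \<in> B" using assms(2) * unfolding is_interval_1 by (meson linear)
      then show False using * assms(3) by blast
    qed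
  qed
  then show ?thesis
  proof
    assume "\<forall>x\<in>A. \<forall>t\<in>B. x < t"
    then have "\<forall>x\<in>A. \<forall>t\<in>B. 1 / (x - t) = -1 / \<bar>x - t\<bar> \<and> x \<noteq> t"
      by (fastforce simp: abs_if field_simps)
    then show ?thesis by blast
  next
    assume "\<forall>x\<in>A. \<forall>t\<in>B. t < x"
    then have "\<forall>x\<in>A. \<forall>t\<in>B. 1 / (x - t) = 1 / \<bar>x - t\<bar> \<and> x \<noteq> t"
      by (fastforce simp: abs_if field_simps)
    then show ?thesis by blast
  qed
qed

text \<open>The reflection i -> m + 1 - i reverses index lists; all statements about the reversed
  system are transported by it. The bound on k keeps the truncated subtractions exact.\<close>

lemma map_reflect_upt:
  assumes "k \<le> Suc m"
  shows "map (\<lambda>i. f (Suc m - i)) [j..<k] = rev (map f [Suc (Suc m) - k..<Suc (Suc m) - j])"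
proof (rule nth_equalityI)
  fix i assume "i < length (map (\<lambda>i. f (Suc m - i)) [j..<k])"
  then have "Suc m - (j + i) = Suc (Suc m) - k + (k - j - Suc i)" "i < k - j"
    "length [Suc (Suc m) - k..<Suc (Suc m) - j] = k - j" "k - j - Suc i < k - j" using assms by auto
  then show "map (\<lambda>i. f (Suc m - i)) [j..<k] ! i = rev (map f [Suc (Suc m) - k..<Suc (Suc m) - j]) ! i"
    by (simp add: rev_nth nth_append)
qed (use assms in auto)

lemma nik_self: "nik \<sigma> j j = \<sigma> j"
  by (simp add: nik_def)

lemma nik_less: "j < k \<Longrightarrow> nik \<sigma> j k = csprod (\<sigma> j) (nik \<sigma> (Suc j) k)"
  by (simp add: nik_def upt_conv_Cons del: upt_Suc)

lemma nik_reflect: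
  assumes "j \<in> {1..m}" "k \<in> {1..m}"
  shows "nik (\<lambda>i. \<sigma> (Suc m - i)) j k = nik \<sigma> (Suc m - j) (Suc m - k)"
proof (cases j k rule: linorder_cases)
  case less
  then have "\<not> Suc m - j \<le> Suc m - k" "Suc (Suc m) - j = Suc (Suc m - j)" using assms by auto
  then show ?thesis using less map_reflect_upt[of "Suc k" m \<sigma> j] assms
    by (simp add: nik_def rev_map del: upt_Suc)
next
  case greater
  then have "Suc m - j \<le> Suc m - k" "\<not> j \<le> k" "Suc (Suc m) - k = Suc (Suc m - k)" using assms by auto
  then show ?thesis using map_reflect_upt[of "Suc j" m \<sigma> k] assms
    by (simp add: nik_def rev_map[symmetric] del: upt_Suc)
qed (simp add: nik_self)

text \<open>A locale, so that each result is available both for the generators and, by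
  \<open>nikishin_reflect\<close>, for their reflection.\<close>

locale nikishin =
  fixes m :: nat and \<Delta> :: "nat \<Rightarrow> real set" and \<sigma> :: "nat \<Rightarrow> csmeasure"
  assumes m2: "2 \<le> m" and gen: "nikishin_generators m \<Delta> \<sigma>"
begin

abbreviation mu :: "nat \<Rightarrow> real measure" where "mu j \<equiv> mmod (\<sigma> j)"

lemma interval: "1 \<le> j \<Longrightarrow> j \<le> m \<Longrightarrow> is_interval (\<Delta> j)"
  using gen unfolding nikishin_generators_def by auto

lemma sigma_class: "1 \<le> j \<Longrightarrow> j \<le> m \<Longrightarrow> \<sigma> j \<in> class_M (\<Delta> j)"
  using gen unfolding nikishin_generators_def by auto

lemma sigma_sign: "1 \<le> j \<Longrightarrow> j \<le> m \<Longrightarrow> msign (\<sigma> j) \<in> {1, -1}"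
  using sigma_class[of j] unfolding class_M_def by blast

lemma nik_class: "1 \<le> j \<Longrightarrow> j \<le> k \<Longrightarrow> k \<le> m \<Longrightarrow> nik \<sigma> j k \<in> class_M (\<Delta> j)"
  using gen unfolding nikishin_generators_def by auto

lemma nik_defined: "1 \<le> j \<Longrightarrow> j < k \<Longrightarrow> k \<le> m \<Longrightarrow> csprod_defined (\<sigma> j) (nik \<sigma> (Suc j) k)"
  using gen unfolding nikishin_generators_def by auto

lemma touching:
  assumes "1 \<le> j" "j < m"
  shows "\<Delta> j \<inter> \<Delta> (Suc j) = {} \<or>
    (\<exists>x. \<Delta> j \<inter> \<Delta> (Suc j) = {x} \<and> emeasure (mu j) {x} = 0 \<and> emeasure (mu (Suc j)) {x} = 0)"
  using gen assms unfolding nikishin_generators_def by auto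

lemma infinite_\<Delta>: "1 \<le> j \<Longrightarrow> j \<le> m \<Longrightarrow> infinite (\<Delta> j)"
  using sigma_class[of j] finite_subset unfolding class_M_def by blast

lemma mu_borel_finite: "1 \<le> j \<Longrightarrow> j \<le> m \<Longrightarrow> borel_finite (mu j)"
  by (rule class_M_borel_finite[OF sigma_class])

lemma list_borel_finite: "1 \<le> j \<Longrightarrow> k \<le> Suc m \<Longrightarrow> list_all borel_finite (map mu [j..<k])"
  by (auto simp: list_all_iff intro: mu_borel_finite)

lemma list_chain_measurable: "1 \<le> j \<Longrightarrow> k \<le> Suc m \<Longrightarrow> list_all (\<lambda>s. borel_finite (mmod s)) (map \<sigma> [j..<k])"
  by (auto simp: list_all_iff intro: mu_borel_finite)

text \<open>A common point of two consecutive intervals is a null set for both measures, so one may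
  remove it; afterwards consecutive intervals are disjoint.\<close>

definition E :: "nat \<Rightarrow> real set" where
  "E j = {x \<in> \<Delta> j. (1 < j \<longrightarrow> x \<notin> \<Delta> (j - 1)) \<and> (j < m \<longrightarrow> x \<notin> \<Delta> (Suc j))}"

lemma E_subset: "E j \<subseteq> \<Delta> j"
  by (auto simp: E_def)

lemma E_next: "x \<in> E j \<Longrightarrow> j < m \<Longrightarrow> x \<notin> \<Delta> (Suc j)"
  by (auto simp: E_def)

lemma E_prev: "x \<in> E (Suc j) \<Longrightarrow> 1 \<le> j \<Longrightarrow> x \<notin> \<Delta> j"
  by (auto simp: E_def)

lemma E_disjoint: "j < m \<Longrightarrow> E j \<inter> E (Suc j) = {}"
  using E_next E_subset by blast

lemma E_interval:
  assumes "1 \<le> j" "j \<le> m" shows "is_interval (E j)"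
proof -
  have l: "is_interval {x \<in> \<Delta> j. 1 < j \<longrightarrow> x \<notin> \<Delta> (j - 1)}"
  proof (cases "1 < j")
    case True
    then obtain i where i: "j = Suc i" "1 \<le> i" "i < m" using assms by (cases j) auto
    have "is_interval (\<Delta> j - \<Delta> i)"
      using i touching[of i] interval[of j] interval[of i] infinite_\<Delta>[of i]
      by (intro is_interval_diff) (auto simp: Int_commute)
    then show ?thesis using True i by (simp add: set_diff_eq)
  qed (use assms interval in simp)
  have r: "is_interval {x \<in> \<Delta> j. j < m \<longrightarrow> x \<notin> \<Delta> (Suc j)}"
  proof (cases "j < m")
    case True
    then have "is_interval (\<Delta> j - \<Delta> (Suc j))"
      using assms touching[of j] interval[of j] interval[of "Suc j"] infinite_\<Delta>[of "Suc j"]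
      by (intro is_interval_diff) auto
    then show ?thesis using True by (simp add: set_diff_eq)
  qed (use assms interval in simp)
  have "E j = {x \<in> \<Delta> j. 1 < j \<longrightarrow> x \<notin> \<Delta> (j - 1)} \<inter> {x \<in> \<Delta> j. j < m \<longrightarrow> x \<notin> \<Delta> (Suc j)}"
    by (auto simp: E_def)
  then show ?thesis using is_interval_Int[OF l r] by simp
qed

lemma AE_E:
  assumes "1 \<le> j" "j \<le> m" shows "AE x in mu j. x \<in> E j"
proof -
  note s = sigma_class[OF assms]
  have l: "AE x in mu j. x \<in> \<Delta> j \<longrightarrow> 1 < j \<longrightarrow> x \<notin> \<Delta> (j - 1)"
  proof (cases "1 < j \<and> \<Delta> (j - 1) \<inter> \<Delta> j \<noteq> {}")
    case True
    then obtain i where i: "j = Suc i" "1 \<le> i" "i < m" using assms by (cases j) auto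
    then obtain x where x: "\<Delta> (j - 1) \<inter> \<Delta> j = {x}" "emeasure (mu j) {x} = 0"
      using touching[of i] True by auto
    then have "AE y in mu j. y \<notin> {x}"
      using class_M_sets[OF s] by (intro AE_not_in) (simp add: null_sets_def)
    then show ?thesis by eventually_elim (use x(1) in auto)
  qed auto
  have r: "AE x in mu j. x \<in> \<Delta> j \<longrightarrow> j < m \<longrightarrow> x \<notin> \<Delta> (Suc j)"
  proof (cases "j < m \<and> \<Delta> j \<inter> \<Delta> (Suc j) \<noteq> {}")
    case True
    then obtain x where x: "\<Delta> j \<inter> \<Delta> (Suc j) = {x}" "emeasure (mu j) {x} = 0"
      using touching[of j] assms by auto
    then have "AE y in mu j. y \<notin> {x}"
      using class_M_sets[OF s] by (intro AE_not_in) (simp add: null_sets_def)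
    then show ?thesis by eventually_elim (use x(1) in auto)
  qed auto
  show ?thesis using class_M_AE[OF s] l r by eventually_elim (auto simp: E_def)
qed

lemma E_sign:
  assumes "1 \<le> j" "j < m"
  shows "\<exists>c\<in>{1, -1::real}. \<forall>x\<in>E j. \<forall>t\<in>E (Suc j). 1 / (x - t) = c / \<bar>x - t\<bar> \<and> x \<noteq> t"
  using assms by (intro disjoint_intervals_sign E_interval E_disjoint) auto

text \<open>On \<open>E j\<close> x \<open>E (Suc j)\<close> the factor 1/(x - t) has constant sign,
  so the absolute value passes inside the Cauchy integral. The assumption \<open>dens\<close> is
  \<open>mmod_nik\<close> one level further in; it is supplied by the induction there, whose step
  rests on this lemma.\<close>

lemma abs_cauchy_nik_aux:
  assumes jk: "1 \<le> j" "j < k" "k \<le> m" and x: "x \<in> E j"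
    and dens: "mmod (nik \<sigma> (Suc j) k) = density (mu (Suc j)) (abs_chain (map mu [Suc (Suc j)..<Suc k]))"
  shows "ennreal \<bar>cauchy (nik \<sigma> (Suc j) k) x\<bar> = abs_chain (map mu [Suc j..<Suc k]) x"
proof -
  define s where "s = nik \<sigma> (Suc j) k"
  define g where "g = abs_chain (map mu [Suc (Suc j)..<Suc k])"
  have s: "s \<in> class_M (\<Delta> (Suc j))" unfolding s_def using jk by (intro nik_class) auto
  have x': "x \<notin> \<Delta> (Suc j)" using E_next[OF x] jk by simp
  have [measurable]: "g \<in> borel_measurable borel"
    unfolding g_def using jk by (intro abs_chain_measurable list_borel_finite) auto
  have sb: "sets (mu (Suc j)) = sets borel" using sigma_class[of "Suc j"] jk class_M_sets by auto
  note [measurable_cong] = sb class_M_sets[OF s]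
  have d: "mmod s = density (mu (Suc j)) g" using dens by (simp add: s_def g_def)
  obtain c where c: "c \<in> {1, -1}" "\<And>t. t \<in> E (Suc j) \<Longrightarrow> 1 / (x - t) = c / \<bar>x - t\<bar>"
    using E_sign[of j] jk x by (metis order_less_le_trans)
  have "AE t in mu (Suc j). t \<in> E (Suc j)" using AE_E[of "Suc j"] jk by simp
  then have "AE t in mu (Suc j). g t > 0 \<longrightarrow> t \<in> E (Suc j)" by (rule eventually_mono) simp
  then have AE: "AE t in mmod s. t \<in> E (Suc j)"
    unfolding d by (subst AE_density) auto
  have i: "integrable (mmod s) (\<lambda>t. 1 / (x - t))"
    by (rule integrable_over_linear_real[OF s x', of "\<lambda>_. 1"])
      (use class_M_finite[OF s] in \<open>simp add: finite_measure.emeasure_finite[THEN less_top[THEN iffD1]] finite_measure.integrable_const\<close>)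
  then have i': "integrable (mmod s) (\<lambda>t. 1 / \<bar>x - t\<bar>)"
    using integrable_abs[OF i] by simp
  have "(\<integral>t. 1 / (x - t) \<partial>mmod s) = (\<integral>t. c * (1 / \<bar>x - t\<bar>) \<partial>mmod s)"
    using AE c(2) by (intro integral_cong_AE) (auto elim!: eventually_mono)
  then have "\<bar>cauchy s x\<bar> = \<bar>\<integral>t. 1 / \<bar>x - t\<bar> \<partial>mmod s\<bar>"
    using s c(1) by (auto simp: cauchy_def cs_integral_def class_M_def abs_mult)
  also have "\<dots> = (\<integral>t. 1 / \<bar>x - t\<bar> \<partial>mmod s)" by (intro abs_of_nonneg integral_nonneg_AE) auto
  finally have "ennreal \<bar>cauchy s x\<bar> = (\<integral>\<^sup>+t. ennreal (1 / \<bar>x - t\<bar>) \<partial>mmod s)"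
    using nn_integral_eq_integral[OF i'] by simp
  also have "\<dots> = (\<integral>\<^sup>+t. g t * ennreal (1 / \<bar>x - t\<bar>) \<partial>mu (Suc j))"
    unfolding d by (rule nn_integral_density) auto
  also have "\<dots> = abs_chain (map mu [Suc j..<Suc k]) x"
    using jk unfolding g_def by (simp add: upt_conv_Cons mult.commute del: upt_Suc)
  finally show ?thesis unfolding s_def .
qed

text \<open>Downward induction from j = k: each \<open>csprod\<close> contributes the modulus of a
  Cauchy transform as density, and this modulus is again a chain. Touching points do not matter,
  since \<open>E j\<close> has full measure.\<close>

lemma mmod_nik:
  assumes "1 \<le> j" "j \<le> k" "k \<le> m"
  shows "mmod (nik \<sigma> j k) = density (mu j) (abs_chain (map mu [Suc j..<Suc k]))"
  using assms(2,1)
proof (induction j rule: inc_induct)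
  case base
  have "abs_chain [] = (\<lambda>_. 1)" by (simp add: fun_eq_iff)
  then show ?case by (simp add: nik_self density_1)
next
  case (step j)
  have j: "1 \<le> j" "j < k" using step by auto
  note sb [measurable_cong] = class_M_sets[OF sigma_class[of j]]
  have "mmod (nik \<sigma> j k) = density (mu j) (\<lambda>x. ennreal \<bar>cauchy (nik \<sigma> (Suc j) k) x\<bar>)"
    using j by (simp add: nik_less csprod_def)
  also have "\<dots> = density (mu j) (abs_chain (map mu [Suc j..<Suc k]))"
  proof (rule density_cong)
    have "cauchy (nik \<sigma> (Suc j) k) \<in> borel_measurable (mu j)"
      using nik_defined[OF j assms(3)] unfolding csprod_defined_def by auto
    then show "(\<lambda>x. ennreal \<bar>cauchy (nik \<sigma> (Suc j) k) x\<bar>) \<in> borel_measurable (mu j)" by measurable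
    have "abs_chain (map mu [Suc j..<Suc k]) \<in> borel_measurable borel"
      using j assms(3) by (intro abs_chain_measurable list_borel_finite) auto
    then show "abs_chain (map mu [Suc j..<Suc k]) \<in> borel_measurable (mu j)"
      using sb j assms(3) by (simp cong: measurable_cong_sets)
    have "AE x in mu j. x \<in> E j" using AE_E[of j] j assms(3) by simp
    then show "AE x in mu j. ennreal \<bar>cauchy (nik \<sigma> (Suc j) k) x\<bar> = abs_chain (map mu [Suc j..<Suc k]) x"
      by (rule eventually_mono) (rule abs_cauchy_nik_aux[OF j assms(3) _ step.IH], auto)
  qed
  finally show ?case .
qed

section \<open>Finiteness and constant sign of the kernels\<close>

lemma abs_chain_finite:
  assumes "1 \<le> j" "j \<le> k" "k \<le> m" "x \<in> E j"
  shows "abs_chain (map mu [Suc j..<Suc k]) x < \<infinity>"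
proof (cases "j = k")
  case False
  then have "ennreal \<bar>cauchy (nik \<sigma> (Suc j) k) x\<bar> = abs_chain (map mu [Suc j..<Suc k]) x"
    using assms by (intro abs_cauchy_nik_aux mmod_nik) auto
  \<comment> \<open>The chain is \<open>ennreal\<close> of a real number, the modulus of a
    convergent Cauchy integral at a point outside \<open>\<Delta> (Suc j)\<close>.\<close>
  then show ?thesis by (metis ennreal_less_top infinity_ennreal_def)
qed simp

text \<open>An absolute moment of s_(j,k), finite because s_(j,k) belongs to
  \<open>class_M\<close>.\<close>

lemma abs_chain_moment:
  fixes p :: "complex poly"
  assumes "1 \<le> j" "j \<le> k" "k \<le> m"
  shows "(\<integral>\<^sup>+x. ennreal (norm (poly p (of_real x))) * abs_chain (map mu [Suc j..<Suc k]) x \<partial>mu j) < \<infinity>"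
proof -
  have [measurable]: "abs_chain (map mu [Suc j..<Suc k]) \<in> borel_measurable borel"
    using assms by (intro abs_chain_measurable list_borel_finite) auto
  have sb: "sets (mu j) = sets borel" using class_M_sets[OF sigma_class[of j]] assms by simp
  note [measurable_cong] = sb
  have [measurable]: "(\<lambda>x. poly p (complex_of_real x)) \<in> borel_measurable borel"
    unfolding poly_altdef by measurable
  have "integrable (mmod (nik \<sigma> j k)) (\<lambda>x. poly p (of_real x))"
    using nik_class assms by (intro class_M_integrable_poly)
  then have "(\<integral>\<^sup>+x. ennreal (norm (poly p (of_real x))) \<partial>mmod (nik \<sigma> j k)) < \<infinity>"
    by (simp add: integrable_iff_bounded)
  then show ?thesis
    unfolding mmod_nik[OF assms]
    by (subst (asm) nn_integral_density) (simp_all add: mult.commute del: upt_Suc)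
qed

text \<open>The requirements on generators are symmetric in s_(j,k) and s_(k,j); reflection
  exchanges the two families.\<close>

lemma nikishin_reflect: "nikishin m (\<lambda>i. \<Delta> (Suc m - i)) (\<lambda>i. \<sigma> (Suc m - i))"
proof
  show "nikishin_generators m (\<lambda>i. \<Delta> (Suc m - i)) (\<lambda>i. \<sigma> (Suc m - i))"
    unfolding nikishin_generators_def
  proof (intro conjI ballI)
    fix j assume j: "j \<in> {1..m}"
    then have j': "Suc m - j \<in> {1..m}" by auto
    show "is_interval (\<Delta> (Suc m - j))" "\<sigma> (Suc m - j) \<in> class_M (\<Delta> (Suc m - j))"
      "convex hull (supp (\<sigma> (Suc m - j))) = \<Delta> (Suc m - j)"
      using gen j' unfolding nikishin_generators_def by blast+
    fix k assume k: "k \<in> {j..m}"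
    define j' k' where "j' = Suc m - k" and "k' = Suc m - j"
    have jk: "j' \<in> {1..m}" "k' \<in> {j'..m}" "j < k \<longleftrightarrow> j' < k'" using j k by (auto simp: j'_def k'_def)
    note g = conjunct2[OF conjunct2[OF gen[unfolded nikishin_generators_def]], rule_format, OF jk(1,2)]
    show "nik (\<lambda>i. \<sigma> (Suc m - i)) j k \<in> class_M (\<Delta> (Suc m - j))"
      "nik (\<lambda>i. \<sigma> (Suc m - i)) k j \<in> class_M (\<Delta> (Suc m - k))"
      using g j k by (auto simp: nik_reflect j'_def k'_def)
    show "j < k \<longrightarrow>
       csprod_defined (\<sigma> (Suc m - j)) (nik (\<lambda>i. \<sigma> (Suc m - i)) (j + 1) k) \<and>
       csprod_defined (\<sigma> (Suc m - k)) (nik (\<lambda>i. \<sigma> (Suc m - i)) (k - 1) j)"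
    proof
      assume "j < k"
      then have "k - 1 \<in> {1..m}" using j k by auto
      then have "nik (\<lambda>i. \<sigma> (Suc m - i)) (j + 1) k = nik \<sigma> (k' - 1) j'"
        "nik (\<lambda>i. \<sigma> (Suc m - i)) (k - 1) j = nik \<sigma> (j' + 1) k'"
        using j k \<open>j < k\<close> nik_reflect[of "j + 1" m k \<sigma>] nik_reflect[of "k - 1" m j \<sigma>]
        by (auto simp: j'_def k'_def Suc_diff_le)
      then show "csprod_defined (\<sigma> (Suc m - j)) (nik (\<lambda>i. \<sigma> (Suc m - i)) (j + 1) k) \<and>
       csprod_defined (\<sigma> (Suc m - k)) (nik (\<lambda>i. \<sigma> (Suc m - i)) (k - 1) j)"
        using g jk(3) \<open>j < k\<close> by (simp add: j'_def k'_def)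
    qed
  next
    fix j assume j: "j \<in> {1..<m}"
    then have "1 \<le> m - j" "m - j < m" "Suc m - j = Suc (m - j)" "Suc m - (j + 1) = m - j" by auto
    then show "\<Delta> (Suc m - j) \<inter> \<Delta> (Suc m - (j + 1)) = {} \<or>
       (\<exists>x. \<Delta> (Suc m - j) \<inter> \<Delta> (Suc m - (j + 1)) = {x} \<and>
         emeasure (mmod (\<sigma> (Suc m - j))) {x} = 0 \<and> emeasure (mmod (\<sigma> (Suc m - (j + 1)))) {x} = 0)"
      using touching[of "m - j"] by (auto simp: Int_commute)
  qed
qed (rule m2)

text \<open>The same moment bound for s_(k,j), obtained in the reflected system.\<close>

lemma abs_chain_rev_moment:
  fixes p :: "complex poly"
  assumes "1 \<le> j" "j \<le> k" "k \<le> m"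
  shows "(\<integral>\<^sup>+y. ennreal (norm (poly p (of_real y))) * abs_chain (rev (map mu [j..<k])) y \<partial>mu k) < \<infinity>"
proof -
  have eq: "Suc (Suc m) - Suc (Suc m - j) = j" "Suc (Suc m) - Suc (Suc m - k) = k" "Suc m - (Suc m - k) = k"
    using assms by auto
  have "(\<integral>\<^sup>+x. ennreal (norm (poly p (of_real x))) *
     abs_chain (map (\<lambda>i. mu (Suc m - i)) [Suc (Suc m - k)..<Suc (Suc m - j)]) x \<partial>mu (Suc m - (Suc m - k))) < \<infinity>"
    using assms by (intro nikishin.abs_chain_moment[OF nikishin_reflect]) auto
  then show ?thesis
    using assms by (subst (asm) map_reflect_upt[where f = mu]) (auto simp only: eq)
qed

lemma abs_kernel_finite:
  assumes jk: "1 \<le> j" "j < k" "k \<le> m" and xy: "x \<in> E j" "y \<in> E k"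
  shows "abs_kernel (map mu [Suc j..<k]) x y < \<infinity>"
proof (cases "k = Suc j")
  case False
  define l where "l = k - 1"
  have l: "k = Suc l" "j < l" "l < m" using jk False by (auto simp: l_def)
  have bf: "list_all borel_finite (map mu [Suc j..<l])" "borel_finite (mu l)"
    using jk l by (auto intro!: list_borel_finite mu_borel_finite)
  note [measurable_cong] = borel_finite_sets[OF bf(2)]
  note [measurable] = abs_kernel_measurable2[OF bf(1)]
  have list: "map mu [Suc j..<k] = map mu [Suc j..<l] @ [mu l]" using l by simp
  \<comment> \<open>Off \<open>\<Delta> l\<close> the last factor 1/|t - y| is at most 1/d almost
    everywhere; what remains is a chain starting from x, already known to be finite.\<close>
  have "y \<notin> \<Delta> l" using E_prev[of y l] xy l jk by simp
  then obtain d where d: "d > 0" "AE t in mu l. d \<le> \<bar>y - t\<bar>"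
    using dist_outside_real[OF sigma_class[of l]] l jk by (metis less_imp_le order_trans)
  have "abs_kernel (map mu [Suc j..<k]) x y
      = (\<integral>\<^sup>+t. abs_kernel (map mu [Suc j..<l]) x t * ennreal (1 / \<bar>t - y\<bar>) \<partial>mu l)"
    unfolding list using bf by (intro abs_kernel_snoc) auto
  also have "\<dots> \<le> (\<integral>\<^sup>+t. abs_kernel (map mu [Suc j..<l]) x t * ennreal (1 / d) \<partial>mu l)"
    using d(2) by (intro nn_integral_mono_AE)
      (auto elim!: eventually_mono intro!: mult_left_mono ennreal_leI frac_le d(1) simp: abs_minus_commute)
  also have "\<dots> = abs_chain (map mu [Suc j..<k]) x * ennreal (1 / d)"
    unfolding list using bf by (simp add: nn_integral_multc abs_chain_snoc)
  also have "\<dots> < \<infinity>"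
    using abs_chain_finite[of j l x] l jk xy by (simp add: ennreal_mult_less_top)
  finally show ?thesis .
qed simp

text \<open>The sign c is the product of one sign for each gap between consecutive intervals and the
  signs of the measures integrated out. Finiteness of \<open>abs_kernel\<close> on these sets makes
  \<open>enn2real\<close> lossless.\<close>

lemma chain_kernel_eq_abs:
  assumes jk: "1 \<le> j" "j < k" "k \<le> m"
  shows "\<exists>c\<in>{1, -1::real}. \<forall>x\<in>E j. \<forall>y\<in>E k.
    chain_kernel (map \<sigma> [Suc j..<k]) x y = c * enn2real (abs_kernel (map mu [Suc j..<k]) x y)"
proof -
  \<comment> \<open>The induction runs downward from l = k - 1 with k fixed; at the start the list
    is empty and the kernel is 1/(x - y).\<close>
  obtain l where l: "k = Suc l" "j \<le> l" "l < m" using jk by (cases k) auto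
  have "\<exists>c\<in>{1, -1::real}. \<forall>x\<in>E i. \<forall>y\<in>E k.
    chain_kernel (map \<sigma> [Suc i..<k]) x y = c * enn2real (abs_kernel (map mu [Suc i..<k]) x y)"
    if "i \<le> l" "1 \<le> i" for i using that
  proof (induction i rule: inc_induct)
    case base
    then show ?case using E_sign[of l] l by auto
  next
    case (step j)
    have j: "1 \<le> j" "j < m" "Suc j < k" using step l by auto
    obtain c1 where c1: "c1 \<in> {1, -1}" "\<And>x y. x \<in> E (Suc j) \<Longrightarrow> y \<in> E k \<Longrightarrow>
      chain_kernel (map \<sigma> [Suc (Suc j)..<k]) x y = c1 * enn2real (abs_kernel (map mu [Suc (Suc j)..<k]) x y)"
      using step.IH[OF le_SucI[OF j(1)]] by blast
    obtain c2 where c2: "c2 \<in> {1, -1}" "\<And>x t. x \<in> E j \<Longrightarrow> t \<in> E (Suc j) \<Longrightarrow> 1 / (x - t) = c2 / \<bar>x - t\<bar>"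
      using E_sign[OF j(1,2)] by blast
    let ?K = "abs_kernel (map mu [Suc (Suc j)..<k])"
    have bf: "list_all borel_finite (map mu [Suc (Suc j)..<k])" "borel_finite (mu (Suc j))"
      using j jk by (auto intro!: list_borel_finite mu_borel_finite)
    note [measurable_cong] = borel_finite_sets[OF bf(2)]
    note [measurable] = abs_kernel_measurable2[OF bf(1)]
    have [measurable]: "(\<lambda>t. chain_kernel (map \<sigma> [Suc (Suc j)..<k]) t y) \<in> borel_measurable borel" for y
      using j jk by (intro chain_kernel_measurable2 list_chain_measurable) auto
    show ?case
    proof (intro bexI[of _ "msign (\<sigma> (Suc j)) * (c1 * c2)"] ballI)
      fix x y assume xy: "x \<in> E j" "y \<in> E k"
      have AE: "AE t in mu (Suc j). t \<in> E (Suc j)" using AE_E[of "Suc j"] j by simp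
      have "(\<integral>t. chain_kernel (map \<sigma> [Suc (Suc j)..<k]) t y / (x - t) \<partial>mu (Suc j))
        = (\<integral>t. (c1 * c2) * (enn2real (?K t y) / \<bar>x - t\<bar>) \<partial>mu (Suc j))"
      proof (rule integral_cong_AE)
        show "AE t in mu (Suc j). chain_kernel (map \<sigma> [Suc (Suc j)..<k]) t y / (x - t)
          = (c1 * c2) * (enn2real (?K t y) / \<bar>x - t\<bar>)"
          using AE
        proof eventually_elim
          case (elim t)
          have "chain_kernel (map \<sigma> [Suc (Suc j)..<k]) t y / (x - t) =
            chain_kernel (map \<sigma> [Suc (Suc j)..<k]) t y * (1 / (x - t))" by simp
          then show ?case using c1(2)[OF elim xy(2)] c2(2)[OF xy(1) elim] by simp
        qed
      qed measurable
      also have "\<dots> = (c1 * c2) * enn2real (\<integral>\<^sup>+t. ennreal (enn2real (?K t y) / \<bar>x - t\<bar>) \<partial>mu (Suc j))"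
        by (subst integral_mult_right_zero, subst integral_eq_nn_integral) auto
      also have "(\<integral>\<^sup>+t. ennreal (enn2real (?K t y) / \<bar>x - t\<bar>) \<partial>mu (Suc j))
        = (\<integral>\<^sup>+t. ennreal (1 / \<bar>x - t\<bar>) * ?K t y \<partial>mu (Suc j))"
      proof (rule nn_integral_cong_AE)
        show "AE t in mu (Suc j). ennreal (enn2real (?K t y) / \<bar>x - t\<bar>) = ennreal (1 / \<bar>x - t\<bar>) * ?K t y"
          using AE
        proof eventually_elim
          case (elim t)
          have "?K t y < \<infinity>" using elim xy(2) j jk by (intro abs_kernel_finite) auto
          then have "?K t y = ennreal (enn2real (?K t y))" by (simp add: less_top)
          then show ?case
            by (metis enn2real_nonneg ennreal_mult' mult.commute mult.right_neutral times_divide_eq_right)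
        qed
      qed
      finally show "chain_kernel (map \<sigma> [Suc j..<k]) x y =
        msign (\<sigma> (Suc j)) * (c1 * c2) * enn2real (abs_kernel (map mu [Suc j..<k]) x y)"
        using j by (simp add: upt_conv_Cons cs_integral_def)
    next
      show "msign (\<sigma> (Suc j)) * (c1 * c2) \<in> {1, -1}"
        using sigma_sign[of "Suc j"] j c1(1) c2(1) by auto
    qed
  qed
  then show ?thesis using jk l by blast
qed

end

section \<open>Integral representation of the multilevel forms\<close>

lemma poly_of_real_measurable [measurable]:
  "(\<lambda>x. poly p (complex_of_real x)) \<in> borel_measurable borel"
  unfolding poly_altdef by measurable

text \<open>The sign chosen in \<open>csprod\<close> undoes the absolute value in its density, so
  integrating against the product is integrating against s1 with the signed weight.\<close>

lemma csprod_integral: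
  fixes g :: "real \<Rightarrow> complex"
  assumes d: "csprod_defined s1 s2" and [measurable]: "g \<in> borel_measurable (mmod s1)"
  shows "integrable (mmod (csprod s1 s2)) g \<longleftrightarrow> integrable (mmod s1) (\<lambda>x. of_real (cauchy s2 x) * g x)"
    and "cs_integral (csprod s1 s2) g = cs_integral s1 (\<lambda>x. of_real (cauchy s2 x) * g x)"
proof -
  have [measurable]: "cauchy s2 \<in> borel_measurable (mmod s1)"
    using d unfolding csprod_defined_def by auto
  define e :: real where "e = (if AE x in mmod s1. cauchy s2 x \<ge> 0 then 1 else -1)"
  have e: "e * e = 1" by (simp add: e_def)
  have sgn: "(AE x in mmod s1. cauchy s2 x \<ge> 0) \<or> (AE x in mmod s1. cauchy s2 x \<le> 0)"
    using d unfolding csprod_defined_def by blast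
  have ae: "AE x in mmod s1. \<bar>cauchy s2 x\<bar> *\<^sub>R g x = of_real e * (of_real (cauchy s2 x) * g x)"
  proof (cases "AE x in mmod s1. cauchy s2 x \<ge> 0")
    case True
    then have "e = 1" by (simp add: e_def)
    with True show ?thesis by (auto elim!: eventually_mono simp: scaleR_conv_of_real)
  next
    case False
    then have "e = -1" "AE x in mmod s1. cauchy s2 x \<le> 0" using sgn by (simp_all add: e_def)
    then show ?thesis by (auto elim!: eventually_mono simp: scaleR_conv_of_real)
  qed
  have m: "mmod (csprod s1 s2) = density (mmod s1) (\<lambda>x. ennreal \<bar>cauchy s2 x\<bar>)"
    and s: "msign (csprod s1 s2) = e * msign s1"
    by (simp_all add: csprod_def e_def)
  have "integrable (mmod (csprod s1 s2)) g \<longleftrightarrow> integrable (mmod s1) (\<lambda>x. \<bar>cauchy s2 x\<bar> *\<^sub>R g x)"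
    unfolding m by (rule integrable_density) auto
  also have "\<dots> \<longleftrightarrow> integrable (mmod s1) (\<lambda>x. of_real e * (of_real (cauchy s2 x) * g x))"
    using ae by (intro integrable_cong_AE) auto
  also have "\<dots> \<longleftrightarrow> integrable (mmod s1) (\<lambda>x. of_real (cauchy s2 x) * g x)"
    by (simp add: e_def)
  finally show "integrable (mmod (csprod s1 s2)) g \<longleftrightarrow> integrable (mmod s1) (\<lambda>x. of_real (cauchy s2 x) * g x)" .
  have "(\<integral>x. g x \<partial>mmod (csprod s1 s2)) = (\<integral>x. \<bar>cauchy s2 x\<bar> *\<^sub>R g x \<partial>mmod s1)"
    unfolding m by (rule integral_density) auto
  also have "\<dots> = (\<integral>x. of_real e * (of_real (cauchy s2 x) * g x) \<partial>mmod s1)"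
    using ae by (intro integral_cong_AE) auto
  also have "\<dots> = of_real e * (\<integral>x. of_real (cauchy s2 x) * g x \<partial>mmod s1)" by simp
  finally show "cs_integral (csprod s1 s2) g = cs_integral s1 (\<lambda>x. of_real (cauchy s2 x) * g x)"
    unfolding cs_integral_def s by (simp add: e_def scaleR_conv_of_real)
qed

context nikishin
begin

lemma mu_sets: "1 \<le> j \<Longrightarrow> j \<le> m \<Longrightarrow> sets (mu j) = sets borel"
  using class_M_sets[OF sigma_class] .

text \<open>General j, not only j = 1, because the Fubini step in \<open>G_Suc\<close> needs the
  kernel that starts one interval further in.\<close>

lemma chain_kernel_integrable:
  fixes p q :: "complex poly"
  assumes j: "1 \<le> j" "j < m"
  shows "integrable (mu j \<Otimes>\<^sub>M mu m)
    (\<lambda>(x, y). poly q (of_real x) * of_real (chain_kernel (map \<sigma> [Suc j..<m]) x y) * poly p (of_real y))"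
proof -
  define Ms where "Ms = map mu [Suc j..<m]"
  define f where "f x y = poly q (of_real x) * of_real (chain_kernel (map \<sigma> [Suc j..<m]) x y) * poly p (of_real y)" for x y
  have bf: "list_all borel_finite Ms" "borel_finite (mu j)" "borel_finite (mu m)"
    using j unfolding Ms_def by (auto intro!: list_borel_finite mu_borel_finite)
  have L: "Ms @ [mu m] = map mu [Suc j..<Suc m]" "rev Ms @ [mu j] = rev (map mu [j..<m])"
    using j unfolding Ms_def by (simp_all add: upt_conv_Cons)
  note [measurable_cong] = borel_finite_sets[OF bf(2)] borel_finite_sets[OF bf(3)]
  note [measurable] = abs_kernel_measurable2[OF bf(1)]
    chain_kernel_measurable2[OF list_chain_measurable[of "Suc j" m]]
  have [measurable]: "(\<lambda>x. poly r (complex_of_real (h x))) \<in> borel_measurable N"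
    if "h \<in> borel_measurable N" for r and h :: "'x \<Rightarrow> real" and N
    using measurable_compose[OF that poly_of_real_measurable] .
  have fm: "case_prod f \<in> borel_measurable (mu j \<Otimes>\<^sub>M mu m)"
    unfolding f_def by measurable
  obtain c where c: "c \<in> {1, -1}" "\<And>x y. x \<in> E j \<Longrightarrow> y \<in> E m \<Longrightarrow>
      chain_kernel (map \<sigma> [Suc j..<m]) x y = c * enn2real (abs_kernel Ms x y)"
    using chain_kernel_eq_abs[of j m] j unfolding Ms_def by blast
  \<comment> \<open>The squares are written as the polynomials \<open>q * q\<close> and
    \<open>p * p\<close>, so that the moment bounds for polynomials apply.\<close>
  let ?q = "\<lambda>x. ennreal (norm (poly (q * q) (complex_of_real x)))"
  let ?p = "\<lambda>y. ennreal (norm (poly (p * p) (complex_of_real y)))"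
  have bound: "ennreal (norm (f x y)) \<le> ?q x * abs_kernel Ms x y + ?p y * abs_kernel Ms x y"
    if "x \<in> E j" "y \<in> E m" for x y
  proof -
    define u v where "u = norm (poly q (complex_of_real x))" and "v = norm (poly p (complex_of_real y))"
    have uv: "0 \<le> u" "0 \<le> v" by (simp_all add: u_def v_def)
    have "0 \<le> (u - v) * (u - v)" by simp
    then have "2 * (u * v) \<le> u * u + v * v" by (simp add: algebra_simps)
    then have le: "u * v \<le> u * u + v * v" using mult_nonneg_nonneg[OF uv] by linarith
    have "abs_kernel Ms x y < \<infinity>"
      unfolding Ms_def using j that by (intro abs_kernel_finite) auto
    then have K: "ennreal (enn2real (abs_kernel Ms x y)) = abs_kernel Ms x y" by (simp add: less_top)
    have "norm (f x y) = (u * v) * enn2real (abs_kernel Ms x y)"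
      using c(1) by (auto simp: f_def c(2)[OF that] norm_mult abs_mult u_def v_def)
    then have "ennreal (norm (f x y)) = ennreal (u * v) * abs_kernel Ms x y"
      using uv K by (simp add: ennreal_mult)
    also have "\<dots> \<le> ennreal (u * u + v * v) * abs_kernel Ms x y"
      using le by (intro mult_right_mono ennreal_leI) auto
    also have "\<dots> = ?q x * abs_kernel Ms x y + ?p y * abs_kernel Ms x y"
      using uv by (simp add: u_def v_def norm_mult distrib_right)
    finally show ?thesis .
  qed
  have "(\<integral>\<^sup>+z. ennreal (norm (case_prod f z)) \<partial>(mu j \<Otimes>\<^sub>M mu m))
     = (\<integral>\<^sup>+x. \<integral>\<^sup>+y. ennreal (norm (f x y)) \<partial>mu m \<partial>mu j)"
    using fm sigma_finite_measure.nn_integral_fst[OF borel_finite_sigma[OF bf(3)],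
        of "\<lambda>z. ennreal (norm (case_prod f z))" "mu j"] by simp
  also have "\<dots> \<le> (\<integral>\<^sup>+x. \<integral>\<^sup>+y. ?q x * abs_kernel Ms x y + ?p y * abs_kernel Ms x y \<partial>mu m \<partial>mu j)"
  proof (rule nn_integral_mono_AE)
    have Em: "AE y in mu m. y \<in> E m" and Ej: "AE x in mu j. x \<in> E j"
      using AE_E[of m] AE_E[of j] m2 j by auto
    show "AE x in mu j. (\<integral>\<^sup>+y. ennreal (norm (f x y)) \<partial>mu m) \<le>
      (\<integral>\<^sup>+y. ?q x * abs_kernel Ms x y + ?p y * abs_kernel Ms x y \<partial>mu m)"
      using Ej
    proof eventually_elim
      case (elim x)
      show ?case
        by (rule nn_integral_mono_AE, rule eventually_mono[OF Em], rule bound[OF elim])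
    qed
  qed
  also have "\<dots> = (\<integral>\<^sup>+x. \<integral>\<^sup>+y. ?q x * abs_kernel Ms x y \<partial>mu m \<partial>mu j)
      + (\<integral>\<^sup>+x. \<integral>\<^sup>+y. ?p y * abs_kernel Ms x y \<partial>mu m \<partial>mu j)"
    by (subst nn_integral_add[symmetric])
      (auto intro!: nn_integral_cong nn_integral_add measurable_nn_integral_borel bf
        simp: measurable_cong_sets[OF borel_finite_sets[OF bf(2)] refl])
  also have "(\<integral>\<^sup>+x. \<integral>\<^sup>+y. ?q x * abs_kernel Ms x y \<partial>mu m \<partial>mu j)
     = (\<integral>\<^sup>+x. ?q x * abs_chain (map mu [Suc j..<Suc m]) x \<partial>mu j)"
    using bf by (simp add: nn_integral_cmult L(1)[symmetric] abs_chain_snoc del: upt_Suc)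
  \<comment> \<open>The p-term needs the other order: integrating x first leaves the reversed chain,
    a moment of s_(m,j), as the q-term gave one of s_(j,m).\<close>
  also have "(\<integral>\<^sup>+x. \<integral>\<^sup>+y. ?p y * abs_kernel Ms x y \<partial>mu m \<partial>mu j)
      = (\<integral>\<^sup>+y. \<integral>\<^sup>+x. ?p y * abs_kernel Ms x y \<partial>mu j \<partial>mu m)"
    by (rule tonelli[OF bf(2,3)]) measurable
  also have "\<dots> = (\<integral>\<^sup>+y. ?p y * abs_chain (rev (map mu [j..<m])) y \<partial>mu m)"
    using bf by (simp add: nn_integral_cmult L(2)[symmetric] abs_chain_snoc abs_kernel_rev list_all_rev)
  also have "(\<integral>\<^sup>+x. ?q x * abs_chain (map mu [Suc j..<Suc m]) x \<partial>mu j)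
      + (\<integral>\<^sup>+y. ?p y * abs_chain (rev (map mu [j..<m])) y \<partial>mu m) < \<infinity>"
    using abs_chain_moment[of j m "q * q"] abs_chain_rev_moment[of j m "p * p"] j by simp
  finally show ?thesis
    unfolding f_def[symmetric] using fm by (intro integrableI_bounded) auto
qed

text \<open>Up to the factor (-1)^m this is A_j on \<open>E j\<close> when p = a_m, but it depends
  on p alone and so makes sense in the nondegeneracy argument. The case j = m is separate because
  the kernel list is empty both for j = m and for j = m - 1.\<close>

definition G :: "complex poly \<Rightarrow> nat \<Rightarrow> real \<Rightarrow> complex" where
  "G p j x = (if j = m then poly p (of_real x) else
     cs_integral (\<sigma> m) (\<lambda>y. of_real (chain_kernel (map \<sigma> [Suc j..<m]) x y) * poly p (of_real y)))"

lemma G_integrable: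
  fixes p q :: "complex poly"
  assumes j: "1 \<le> j" "j \<le> m"
  shows "integrable (mu j) (\<lambda>x. poly q (of_real x) * G p j x)"
proof (cases "j = m")
  case True
  then show ?thesis
    using class_M_integrable_poly[OF sigma_class[OF j], of "q * p"] by (simp add: G_def)
next
  case False
  then have j': "1 \<le> j" "j < m" using j by auto
  have pr: "pair_sigma_finite (mu j) (mu m)"
    using j' by (intro borel_finite_pair mu_borel_finite) auto
  have "(\<lambda>x. poly q (of_real x) * G p j x) = (\<lambda>x. msign (\<sigma> m) *\<^sub>R (\<integral>y. poly q (of_real x) *
      of_real (chain_kernel (map \<sigma> [Suc j..<m]) x y) * poly p (of_real y) \<partial>mu m))"
    using j' by (simp add: G_def cs_integral_def mult.assoc fun_eq_iff)
  then show ?thesis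
    using pair_sigma_finite.integrable_fst[OF pr chain_kernel_integrable[OF j', of q p]]
    by (simp del: integral_mult_right_zero)
qed

lemma G_measurable:
  assumes j: "1 \<le> j" "j \<le> m"
  shows "G p j \<in> borel_measurable borel"
proof -
  have "integrable (mu j) (G p j)" using G_integrable[OF j, of 1] by simp
  then have "G p j \<in> borel_measurable (mu j)" by simp
  then show ?thesis using mu_sets[OF j] by (simp cong: measurable_cong_sets)
qed

text \<open>A point x of \<open>E j\<close> has positive distance from the support of
  \<sigma>_(j+1), so 1/(x - t) is bounded for almost all t. Integrability of the kernel one level
  further in therefore justifies exchanging the integrals.\<close>

lemma G_Suc:
  assumes j: "1 \<le> j" "j < m" and x: "x \<in> E j"
  shows "G p j x = cs_integral (\<sigma> (Suc j)) (\<lambda>t. G p (Suc j) t / (of_real x - of_real t))"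
proof (cases "Suc j = m")
  case True
  then show ?thesis by (auto simp: G_def)
next
  case False
  then have j': "1 \<le> Suc j" "Suc j < m" using j by auto
  let ?k = "\<lambda>t y. chain_kernel (map \<sigma> [Suc (Suc j)..<m]) t y"
  have bf: "borel_finite (mu (Suc j))" "borel_finite (mu m)"
    using j' by (auto intro!: mu_borel_finite)
  have x': "x \<notin> \<Delta> (Suc j)" using E_next[OF x] j by simp
  obtain d where d: "d > 0" "AE t in mu (Suc j). d \<le> \<bar>x - t\<bar>"
    using dist_outside_real[OF sigma_class[of "Suc j"] x'] j' by (metis less_imp_le)
  define g where "g t = 1 / (complex_of_real x - of_real t)" for t
  have [measurable]: "g \<in> borel_measurable borel" unfolding g_def by measurable
  have gb: "AE t in mu (Suc j). norm (g t) \<le> 1 / d"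
    using d(2)
  proof eventually_elim
    case (elim t)
    have "norm (g t) = 1 / \<bar>x - t\<bar>"
      unfolding g_def norm_divide by (metis norm_of_real norm_one of_real_diff)
    then show ?case using elim d(1) by (simp add: frac_le)
  qed
  have "integrable (mu (Suc j) \<Otimes>\<^sub>M mu m) (\<lambda>(t, y). of_real (?k t y) * poly p (of_real y))"
    using chain_kernel_integrable[OF j', of 1 p] by simp
  from integrable_pair_bounded[OF bf this _ gb]
  have int: "integrable (mu (Suc j) \<Otimes>\<^sub>M mu m) (\<lambda>(t, y). g t * (of_real (?k t y) * poly p (of_real y)))"
    by (simp add: case_prod_beta')
  have "G p j x = cs_integral (\<sigma> m) (\<lambda>y. of_real (cs_integral (\<sigma> (Suc j)) (\<lambda>t. ?k t y / (x - t))) * poly p (of_real y))"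
    using j j' by (simp add: G_def upt_conv_Cons)
  also have "\<dots> = cs_integral (\<sigma> m) (\<lambda>y. cs_integral (\<sigma> (Suc j)) (\<lambda>t. g t * (of_real (?k t y) * poly p (of_real y))))"
    unfolding cs_integral_of_real[symmetric] cs_integral_mult_right[symmetric]
    by (simp add: g_def)
  also have "\<dots> = cs_integral (\<sigma> (Suc j)) (\<lambda>t. cs_integral (\<sigma> m) (\<lambda>y. g t * (of_real (?k t y) * poly p (of_real y))))"
    by (rule cs_integral_swap[OF bf int, symmetric])
  also have "\<dots> = cs_integral (\<sigma> (Suc j)) (\<lambda>t. G p (Suc j) t / (of_real x - of_real t))"
    unfolding cs_integral_mult_left using j' by (simp add: G_def g_def)
  finally show ?thesis .
qed

section \<open>The multilevel forms as iterated Cauchy integrals\<close>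

abbreviation ml :: "(nat \<Rightarrow> complex poly) \<Rightarrow> nat \<Rightarrow> complex \<Rightarrow> complex" where
  "ml a j \<equiv> ml_form m (\<lambda>j. nik \<sigma> (Suc j)) a j"

text \<open>The signed density of s_(j,k) with respect to \<sigma>_j. The value 1 for k = j puts
  \<sigma>_j itself into the family, so that A_j becomes one uniform sum.\<close>

definition ml_weight :: "nat \<Rightarrow> nat \<Rightarrow> real \<Rightarrow> real" where
  "ml_weight j k x = (if k = j then 1 else cauchy (nik \<sigma> (Suc j) k) x)"

lemma ml_weight_integral:
  fixes g :: "real \<Rightarrow> complex"
  assumes "1 \<le> j" "j \<le> k" "k \<le> m" "g \<in> borel_measurable borel"
  shows "integrable (mmod (nik \<sigma> j k)) g \<longleftrightarrow> integrable (mu j) (\<lambda>x. of_real (ml_weight j k x) * g x)"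
    and "cs_integral (nik \<sigma> j k) g = cs_integral (\<sigma> j) (\<lambda>x. of_real (ml_weight j k x) * g x)"
proof -
  have m: "g \<in> borel_measurable (mu j)"
    using assms mu_sets[of j] by (simp cong: measurable_cong_sets)
  show "integrable (mmod (nik \<sigma> j k)) g \<longleftrightarrow> integrable (mu j) (\<lambda>x. of_real (ml_weight j k x) * g x)"
  proof (cases "j = k")
    case False
    then have "j < k" using assms by simp
    then show ?thesis using csprod_integral(1)[OF nik_defined[OF assms(1) _ assms(3)] m]
      by (simp only: ml_weight_def nik_less) simp
  qed (simp add: ml_weight_def nik_self)
  show "cs_integral (nik \<sigma> j k) g = cs_integral (\<sigma> j) (\<lambda>x. of_real (ml_weight j k x) * g x)"
  proof (cases "j = k")
    case False
    then have "j < k" using assms by simp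
    then show ?thesis using csprod_integral(2)[OF nik_defined[OF assms(1) _ assms(3)] m]
      by (simp only: ml_weight_def nik_less) simp
  qed (simp add: ml_weight_def nik_self)
qed

lemma ml_of_real:
  assumes "j \<le> m"
  shows "ml a j (of_real x) = (\<Sum>k=j..m. of_real (ml_weight j k x) * ((-1) ^ k * poly (a k) (of_real x)))"
proof -
  have "(\<Sum>k=Suc j..m. of_real (ml_weight j k x) * ((-1) ^ k * poly (a k) (of_real x)))
    = (\<Sum>k=Suc j..m. (-1) ^ k * poly (a k) (of_real x) * cauchy (nik \<sigma> (Suc j) k) (of_real x))"
    by (rule sum.cong) (simp_all add: ml_weight_def cauchy_of_real)
  then show ?thesis
    by (simp add: ml_form_def sum.atLeast_Suc_atMost[OF assms] ml_weight_def)
qed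

lemma ml_integrable:
  assumes j: "1 \<le> j" "j \<le> m"
  shows "integrable (mu j) (\<lambda>x. poly q (of_real x) * ml a j (of_real x))"
proof -
  have "integrable (mu j) (\<lambda>x. \<Sum>k=j..m. of_real (ml_weight j k x) * poly (q * smult ((-1) ^ k) (a k)) (of_real x))"
  proof (rule Bochner_Integration.integrable_sum)
    fix k assume "k \<in> {j..m}"
    then show "integrable (mu j) (\<lambda>x. of_real (ml_weight j k x) * poly (q * smult ((-1) ^ k) (a k)) (of_real x))"
      using ml_weight_integral(1)[of j k "\<lambda>x. poly (q * smult ((-1) ^ k) (a k)) (of_real x)"] j
        class_M_integrable_poly[OF nik_class[of j k], of "q * smult ((-1) ^ k) (a k)"] by simp
  qed
  then show ?thesis
    using j by (simp add: ml_of_real sum_distrib_left mult_ac)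
qed

text \<open>Each a_k times its Cauchy transform is a polynomial plus an integral over s_(j+1,k).
  Written over \<sigma>_(j+1) with the weights, these integrals add up to the Cauchy integral of
  A_(j+1).\<close>

lemma ml_decomposition:
  assumes j: "j < m"
  shows "\<exists>P. \<forall>z. z \<notin> complex_of_real ` \<Delta> (Suc j) \<longrightarrow>
    ml a j z = poly P z + cs_integral (\<sigma> (Suc j)) (\<lambda>x. ml a (Suc j) (of_real x) / (z - of_real x))"
proof -
  have "\<exists>R. \<forall>k\<in>{Suc j..m}. \<forall>z. z \<notin> complex_of_real ` \<Delta> (Suc j) \<longrightarrow>
     poly (a k) z * cauchy (nik \<sigma> (Suc j) k) z =
     poly (R k) z + cs_integral (nik \<sigma> (Suc j) k) (\<lambda>x. poly (a k) (of_real x) / (z - of_real x))"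
    by (intro bchoice ballI poly_mult_cauchy nik_class) auto
  then obtain R where R: "\<And>k z. k \<in> {Suc j..m} \<Longrightarrow> z \<notin> complex_of_real ` \<Delta> (Suc j) \<Longrightarrow>
     poly (a k) z * cauchy (nik \<sigma> (Suc j) k) z =
     poly (R k) z + cs_integral (nik \<sigma> (Suc j) k) (\<lambda>x. poly (a k) (of_real x) / (z - of_real x))"
    by blast
  show ?thesis
  proof (intro exI[of _ "smult ((-1) ^ j) (a j) + (\<Sum>k=Suc j..m. smult ((-1) ^ k) (R k))"] allI impI)
    fix z assume z: "z \<notin> complex_of_real ` \<Delta> (Suc j)"
    let ?w = "\<lambda>k x. complex_of_real (ml_weight (Suc j) k x)"
    have int: "integrable (mu (Suc j)) (\<lambda>x. ?w k x * ((-1) ^ k * poly (a k) (of_real x) / (z - of_real x)))"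
      if "k \<in> {Suc j..m}" for k
    proof -
      have "integrable (mmod (nik \<sigma> (Suc j) k)) (\<lambda>x. poly (smult ((-1) ^ k) (a k)) (of_real x) / (z - of_real x))"
        using that z
        by (intro integrable_over_linear[OF nik_class] class_M_integrable_poly[OF nik_class]) auto
      then show ?thesis
        using that by (subst (asm) ml_weight_integral(1)) (auto simp: mult_ac)
    qed
    have "cs_integral (\<sigma> (Suc j)) (\<lambda>x. ml a (Suc j) (of_real x) / (z - of_real x))
      = cs_integral (\<sigma> (Suc j)) (\<lambda>x. \<Sum>k=Suc j..m. ?w k x * ((-1) ^ k * poly (a k) (of_real x) / (z - of_real x)))"
      using j by (simp add: ml_of_real sum_divide_distrib mult_ac)
    also have "\<dots> = (\<Sum>k=Suc j..m. cs_integral (\<sigma> (Suc j)) (\<lambda>x. ?w k x * ((-1) ^ k * poly (a k) (of_real x) / (z - of_real x))))"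
      by (rule cs_integral_sum[OF int])
    also have "\<dots> = (\<Sum>k=Suc j..m. (-1) ^ k * cs_integral (nik \<sigma> (Suc j) k) (\<lambda>x. poly (a k) (of_real x) / (z - of_real x)))"
    proof (rule sum.cong[OF refl])
      fix k assume k: "k \<in> {Suc j..m}"
      have "cs_integral (nik \<sigma> (Suc j) k) (\<lambda>x. (-1) ^ k * (poly (a k) (of_real x) / (z - of_real x)))
        = cs_integral (\<sigma> (Suc j)) (\<lambda>x. ?w k x * ((-1) ^ k * (poly (a k) (of_real x) / (z - of_real x))))"
        using k by (intro ml_weight_integral) auto
      then show "cs_integral (\<sigma> (Suc j)) (\<lambda>x. ?w k x * ((-1) ^ k * poly (a k) (of_real x) / (z - of_real x)))
        = (-1) ^ k * cs_integral (nik \<sigma> (Suc j) k) (\<lambda>x. poly (a k) (of_real x) / (z - of_real x))"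
        unfolding cs_integral_mult_left by simp
    qed
    also have "\<dots> = (\<Sum>k=Suc j..m. (-1) ^ k * (poly (a k) z * cauchy (nik \<sigma> (Suc j) k) z - poly (R k) z))"
      using R[OF _ z] by (intro sum.cong) auto
    finally show "ml a j z = poly (smult ((-1) ^ j) (a j) + (\<Sum>k=Suc j..m. smult ((-1) ^ k) (R k))) z +
      cs_integral (\<sigma> (Suc j)) (\<lambda>x. ml a (Suc j) (of_real x) / (z - of_real x))"
      by (simp add: ml_form_def poly_sum right_diff_distrib sum_subtractf mult.assoc)
  qed
qed

lemma imaginary_axis: "y > 0 \<Longrightarrow> \<i> * complex_of_real y \<notin> complex_of_real ` D"
  by (auto simp: complex_eq_iff)

lemma ml_tendsto_0:
  assumes HP: "multilevel_HP m \<Delta> \<sigma> n a" and j: "j < m"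
  shows "((\<lambda>y. ml a j (\<i> * of_real y)) \<longlongrightarrow> 0) at_top"
proof -
  have "\<Delta> (Suc j) \<noteq> {}" using infinite_\<Delta>[of "Suc j"] j by auto
  moreover have "bigo_nontang (\<Delta> (Suc j)) (ml a j) (if j = 0 then n + 1 else 1)"
    using HP j unfolding multilevel_HP_def ml_hermite_pade_def by auto
  ultimately show ?thesis
    using bigo_nontang_tendsto_0[of "\<Delta> (Suc j)" "ml a j" _ 0] by auto
qed

text \<open>The identity is found on the imaginary axis, but P = 0 gives it at all z off the
  interval, in particular at real points of \<open>E j\<close>, where it is iterated.\<close>

lemma ml_recursion:
  assumes HP: "multilevel_HP m \<Delta> \<sigma> n a" and j: "j < m" and z: "z \<notin> complex_of_real ` \<Delta> (Suc j)"
  shows "ml a j z = cs_integral (\<sigma> (Suc j)) (\<lambda>x. ml a (Suc j) (of_real x) / (z - of_real x))"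
proof -
  obtain P where P: "\<And>z. z \<notin> complex_of_real ` \<Delta> (Suc j) \<Longrightarrow>
    ml a j z = poly P z + cs_integral (\<sigma> (Suc j)) (\<lambda>x. ml a (Suc j) (of_real x) / (z - of_real x))"
    using ml_decomposition[OF j] by blast
  have int: "integrable (mu (Suc j)) (\<lambda>x. ml a (Suc j) (of_real x))"
    using ml_integrable[of "Suc j" 1 a] j by simp
  have "((\<lambda>y. ml a j (\<i> * of_real y) -
      cs_integral (\<sigma> (Suc j)) (\<lambda>x. ml a (Suc j) (of_real x) / (\<i> * of_real y - of_real x))) \<longlongrightarrow> 0 - 0) at_top"
    using j by (intro tendsto_diff ml_tendsto_0[OF HP] cauchy_integral_tendsto_0[OF sigma_class int]) auto
  moreover have "\<forall>\<^sub>F y in at_top. ml a j (\<i> * of_real y) -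
      cs_integral (\<sigma> (Suc j)) (\<lambda>x. ml a (Suc j) (of_real x) / (\<i> * of_real y - of_real x)) = poly P (\<i> * of_real y)"
    using eventually_gt_at_top[of 0]
    by eventually_elim (simp add: P[OF imaginary_axis])
  ultimately have "((\<lambda>y. poly P (\<i> * of_real y)) \<longlongrightarrow> 0) at_top"
    by (simp add: tendsto_cong)
  then have "P = 0" by (rule poly_tendsto_0_imp_0)
  then show ?thesis using P[OF z] by simp
qed

text \<open>Descending in j: if all later coefficients vanish, A_j is the polynomial (-1)^j a_j and
  tends to 0, hence a_j = 0. In the end the whole vector would be zero.\<close>

lemma HP_leading_nonzero:
  assumes HP: "multilevel_HP m \<Delta> \<sigma> n a"
  shows "a m \<noteq> 0"
proof
  assume a0: "a m = 0"
  have "a j = 0" if "j \<le> m" for j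
    using that
  proof (induction "m - j" arbitrary: j rule: less_induct)
    case less
    show ?case
    proof (cases "j = m")
      case False
      then have j: "j < m" using less by simp
      have "a k = 0" if "k \<in> {j + 1..m}" for k using that less.hyps[of k] by auto
      then have "ml a j z = poly (smult ((-1) ^ j) (a j)) z" for z by (simp add: ml_form_def)
      then have "smult ((-1) ^ j) (a j) = 0"
        using ml_tendsto_0[OF HP j] by (intro poly_tendsto_0_imp_0) simp
      then show ?thesis by simp
    qed (use a0 in simp)
  qed
  then show False using HP unfolding multilevel_HP_def ml_hermite_pade_def by auto
qed

text \<open>Stated on \<open>E j\<close> only, since the recursion needs points off the next
  interval; these points have full measure, which is all the integrals see.\<close>

lemma ml_eq_G:
  assumes HP: "multilevel_HP m \<Delta> \<sigma> n a" and "1 \<le> j" "j \<le> m" "x \<in> E j"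
  shows "ml a j (of_real x) = (-1) ^ m * G (a m) j x"
  using assms(3,2,4)
proof (induction j arbitrary: x rule: inc_induct)
  case base
  then show ?case by (simp add: ml_form_def G_def)
next
  case (step j)
  then have j: "1 \<le> j" "j < m" by auto
  have x: "complex_of_real x \<notin> of_real ` \<Delta> (Suc j)" using E_next[OF step.prems(2) j(2)] by auto
  have s: "sets (mu (Suc j)) = sets borel" using j by (intro mu_sets) auto
  note [measurable_cong] = s
  have [measurable]: "(\<lambda>t. ml a (Suc j) (of_real t)) \<in> borel_measurable (mu (Suc j))"
    using ml_integrable[of "Suc j" 1 a] j by auto
  have [measurable]: "G (a m) (Suc j) \<in> borel_measurable borel" using j by (intro G_measurable) auto
  have "ml a j (of_real x) = cs_integral (\<sigma> (Suc j)) (\<lambda>t. ml a (Suc j) (of_real t) / (of_real x - of_real t))"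
    by (rule ml_recursion[OF HP j(2) x])
  also have "\<dots> = cs_integral (\<sigma> (Suc j)) (\<lambda>t. (-1) ^ m * (G (a m) (Suc j) t / (of_real x - of_real t)))"
  proof (rule cs_integral_cong_AE)
    have "AE t in mu (Suc j). t \<in> E (Suc j)" using AE_E[of "Suc j"] j by simp
    then show "AE t in mu (Suc j). ml a (Suc j) (of_real t) / (of_real x - of_real t) =
       (-1) ^ m * (G (a m) (Suc j) t / (of_real x - of_real t))"
      by eventually_elim (use step.IH j in simp)
  qed measurable
  also have "\<dots> = (-1) ^ m * G (a m) j x"
    unfolding cs_integral_mult_left using G_Suc[OF j step.prems(2)] by simp
  finally show ?case .
qed

lemma HP_orthogonal:
  assumes HP: "multilevel_HP m \<Delta> \<sigma> n a" and \<nu>: "\<nu> < n"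
  shows "cs_integral (\<sigma> 1) (\<lambda>x. of_real x ^ \<nu> * G (a m) 1 x) = 0"
proof -
  have m1: "1 \<le> m" "0 < m" using m2 by auto
  note s = sigma_class[OF order_refl m1(1)]
  note [measurable_cong] = class_M_sets[OF s]
  have int: "integrable (mu 1) (\<lambda>x. of_real x ^ i * ml a 1 (of_real x))" for i
    using ml_integrable[OF order_refl m1(1), of "monom 1 i" a] by (simp add: poly_monom)
  have [measurable]: "(\<lambda>x. ml a 1 (of_real x)) \<in> borel_measurable (mu 1)"
    using int[of 0] by auto
  have [measurable]: "G (a m) 1 \<in> borel_measurable borel" using m1 by (intro G_measurable) auto
  have "cs_integral (\<sigma> 1) (\<lambda>x. of_real x ^ \<nu> * ml a 1 (of_real x)) = 0"
  proof (rule moments_vanish[OF s int _ \<nu>])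
    fix k assume k: "k \<le> n"
    have "\<Delta> 1 \<noteq> {}" using infinite_\<Delta>[of 1] m1 by auto
    moreover have "bigo_nontang (\<Delta> 1) (ml a 0) (n + 1)"
      using HP unfolding multilevel_HP_def ml_hermite_pade_def by auto
    ultimately have "((\<lambda>y. (\<i> * of_real y) ^ k * ml a 0 (\<i> * of_real y)) \<longlongrightarrow> 0) at_top"
      using k by (intro bigo_nontang_tendsto_0) auto
    moreover have "\<forall>\<^sub>F y in at_top. (\<i> * of_real y) ^ k * ml a 0 (\<i> * of_real y) =
        (\<i> * of_real y) ^ k * cs_integral (\<sigma> 1) (\<lambda>x. ml a 1 (of_real x) / (\<i> * of_real y - of_real x))"
      using eventually_gt_at_top[of 0]
      by eventually_elim (use ml_recursion[OF HP m1(2) imaginary_axis] in simp)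
    ultimately show "((\<lambda>y. (\<i> * of_real y) ^ k *
        cs_integral (\<sigma> 1) (\<lambda>x. ml a 1 (of_real x) / (\<i> * of_real y - of_real x))) \<longlongrightarrow> 0) at_top"
      by (rule Lim_transform_eventually)
  qed
  also have "cs_integral (\<sigma> 1) (\<lambda>x. of_real x ^ \<nu> * ml a 1 (of_real x)) =
     cs_integral (\<sigma> 1) (\<lambda>x. (-1) ^ m * (of_real x ^ \<nu> * G (a m) 1 x))"
  proof (rule cs_integral_cong_AE)
    show "AE x in mu 1. of_real x ^ \<nu> * ml a 1 (of_real x) = (-1) ^ m * (of_real x ^ \<nu> * G (a m) 1 x)"
      using AE_E[OF order_refl m1(1)]
      by eventually_elim (use ml_eq_G[OF HP order_refl m1(1)] in simp)
  qed measurable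
  finally show ?thesis unfolding cs_integral_mult_left by simp
qed

end

section \<open>Zeros and orthogonality\<close>

lemma nonzero_constant_sign:
  fixes h :: "real \<Rightarrow> real"
  assumes "is_interval S" "continuous_on S h" "\<And>x. x \<in> S \<Longrightarrow> h x \<noteq> 0"
  shows "(\<forall>x\<in>S. 0 < h x) \<or> (\<forall>x\<in>S. h x < 0)"
proof (rule ccontr)
  assume "\<not> ?thesis"
  then obtain x y where xy: "x \<in> S" "y \<in> S" "h x \<le> 0" "0 \<le> h y" by (meson not_less)
  have "connected (h ` S)"
    using assms(1,2) by (intro connected_continuous_image) (auto simp: is_interval_connected)
  then have "is_interval (h ` S)" by (simp add: is_interval_connected_1)
  then have "0 \<in> h ` S" using xy unfolding is_interval_1 by blast
  then show False using assms(3) by auto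
qed

text \<open>Zeros are added from left to right, the largest last. A factor is inserted only where
  the sign changes, so the degree is bounded by, not equal to, the number of zeros.\<close>

lemma sign_matching_poly:
  fixes h :: "real \<Rightarrow> real"
  assumes "finite Z" "is_interval S" "continuous_on S h" "{x \<in> S. h x = 0} = Z"
  shows "\<exists>q :: real poly. degree q \<le> card Z \<and> (\<forall>x\<in>S. 0 \<le> poly q x * h x) \<and> (\<forall>x. poly q x = 0 \<longrightarrow> x \<in> Z)"
  using assms
proof (induction Z arbitrary: S rule: finite_linorder_max_induct)
  case empty
  then have "\<And>x. x \<in> S \<Longrightarrow> h x \<noteq> 0" by blast
  from nonzero_constant_sign[OF empty(1,2) this] show ?case
  proof
    assume "\<forall>x\<in>S. 0 < h x"
    then show ?thesis by (intro exI[of _ 1]) (auto intro: less_imp_le)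
  next
    assume "\<forall>x\<in>S. h x < 0"
    then show ?thesis by (intro exI[of _ "- 1"]) (auto intro: less_imp_le)
  qed
next
  case (insert b A)
  have S1: "is_interval (S \<inter> {..<b})" "is_interval (S \<inter> {b<..})"
    using insert.prems(1) by (auto intro!: is_interval_Int)
  have "continuous_on (S \<inter> {..<b}) h" using insert.prems(2) by (rule continuous_on_subset) auto
  moreover have "{x \<in> S \<inter> {..<b}. h x = 0} = A"
    using insert.prems(3) insert.hyps(2) by auto
  ultimately obtain q where q: "degree q \<le> card A" "\<And>x. x \<in> S \<Longrightarrow> x < b \<Longrightarrow> 0 \<le> poly q x * h x"
    "\<And>x. poly q x = 0 \<Longrightarrow> x \<in> A"
    using insert.IH[OF S1(1)] by auto
  have hb: "h b = 0" using insert.prems(3) by auto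
  have card: "card (insert b A) = Suc (card A)" using insert.hyps by auto
  have "continuous_on (S \<inter> {b<..}) (\<lambda>x. poly q x * h x)"
    using insert.prems(2) by (intro continuous_on_mult continuous_on_poly continuous_on_id) (auto intro: continuous_on_subset)
  moreover have "poly q x * h x \<noteq> 0" if "x \<in> S \<inter> {b<..}" for x
  proof -
    have "x \<notin> A" using that insert.hyps(2) by auto
    moreover have "h x \<noteq> 0" using that insert.prems(3) insert.hyps(2) by fastforce
    ultimately show ?thesis using q(3) by auto
  qed
  ultimately have "(\<forall>x\<in>S \<inter> {b<..}. 0 < poly q x * h x) \<or> (\<forall>x\<in>S \<inter> {b<..}. poly q x * h x < 0)"
    by (rule nonzero_constant_sign[OF S1(2)])
  then show ?case
  proof
    assume pos: "\<forall>x\<in>S \<inter> {b<..}. 0 < poly q x * h x"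
    have "0 \<le> poly q x * h x" if "x \<in> S" for x
      using q(2)[OF that] pos hb that by (cases x b rule: linorder_cases) (auto intro: less_imp_le)
    then show ?thesis using q card by (intro exI[of _ q]) auto
  next
    assume neg: "\<forall>x\<in>S \<inter> {b<..}. poly q x * h x < 0"
    \<comment> \<open>The factor is b - x rather than x - b: it is positive left of b, where the
      sign is already right, and flips it to the right of b.\<close>
    have eq: "poly (q * [:b, -1:]) x * h x = (b - x) * (poly q x * h x)" for x
      by (simp add: algebra_simps)
    have "0 \<le> poly (q * [:b, -1:]) x * h x" if "x \<in> S" for x
    proof (cases "b < x")
      case True
      then have "poly q x * h x < 0" using neg that by auto
      then show ?thesis unfolding eq using True by (intro mult_nonpos_nonpos) auto
    next
      case False
      then show ?thesis unfolding eq using q(2)[OF that] hb by (cases "x = b") auto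
    qed
    moreover have "degree (q * [:b, -1:]) \<le> card (insert b A)"
      using degree_mult_le[of q "[:b, -1:]"] q(1) card by simp
    moreover have "x \<in> insert b A" if "poly (q * [:b, -1:]) x = 0" for x
      using that q(3) by auto
    ultimately show ?thesis by blast
  qed
qed

text \<open>With fewer than N zeros, a sign-matching q has degree below N, so q h is nonnegative
  with integral 0. The measure would then live on the finite zero set. If there are more zeros, even
  infinitely many, N of them are selected.\<close>

lemma zeros_of_orthogonal:
  fixes h :: "real \<Rightarrow> real"
  assumes s: "s \<in> class_M D" and S: "is_interval S" "AE x in mmod s. x \<in> S" and h: "continuous_on S h"
    and int: "\<And>\<nu>. \<nu> < N \<Longrightarrow> integrable (mmod s) (\<lambda>x. x ^ \<nu> * h x)"
    and orth: "\<And>\<nu>. \<nu> < N \<Longrightarrow> (\<integral>x. x ^ \<nu> * h x \<partial>mmod s) = 0"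
  shows "\<exists>Z\<subseteq>S. finite Z \<and> card Z = N \<and> (\<forall>z\<in>Z. h z = 0)"
proof -
  define Z where "Z = {x \<in> S. h x = 0}"
  have "\<not> (finite Z \<and> card Z < N)"
  proof
    assume Z: "finite Z \<and> card Z < N"
    obtain q :: "real poly" where q: "degree q \<le> card Z" "\<And>x. x \<in> S \<Longrightarrow> 0 \<le> poly q x * h x"
      "\<And>x. poly q x = 0 \<Longrightarrow> x \<in> Z"
      using sign_matching_poly[OF _ S(1) h Z_def[symmetric]] Z by blast
    have eq: "(\<lambda>x. poly q x * h x) = (\<lambda>x. \<Sum>i\<le>degree q. coeff q i * (x ^ i * h x))"
      by (simp add: poly_altdef sum_distrib_right mult.assoc)
    have iq: "integrable (mmod s) (\<lambda>x. poly q x * h x)"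
      unfolding eq using q(1) Z by (intro Bochner_Integration.integrable_sum integrable_mult_right int) auto
    have "(\<integral>x. poly q x * h x \<partial>mmod s) = (\<Sum>i\<le>degree q. coeff q i * (\<integral>x. x ^ i * h x \<partial>mmod s))"
      unfolding eq using q(1) Z
      by (subst Bochner_Integration.integral_sum) (auto intro!: integrable_mult_right int)
    also have "\<dots> = 0" using q(1) Z by (intro sum.neutral) (auto simp: orth)
    finally have z: "(\<integral>x. poly q x * h x \<partial>mmod s) = 0" .
    have "AE x in mmod s. 0 \<le> poly q x * h x" using S(2) by eventually_elim (rule q(2))
    then have "AE x in mmod s. poly q x * h x = 0"
      using z integral_nonneg_eq_0_iff_AE[OF iq] by simp
    with S(2) have "AE x in mmod s. x \<in> Z"
      by eventually_elim (use q(3) in \<open>auto simp: Z_def\<close>)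
    then have "supp s \<subseteq> Z" using Z by (intro supp_subset_finite class_M_sets[OF s]) auto
    then show False using Z s finite_subset unfolding class_M_def by auto
  qed
  then obtain Y where "Y \<subseteq> Z" "finite Y" "card Y = N"
    by (metis infinite_arbitrarily_large not_less obtain_subset_with_card_n)
  then show ?thesis unfolding Z_def by auto
qed

lemma partial_fractions:
  fixes r :: "real poly"
  assumes "finite Z" "degree r < card Z"
  shows "\<exists>c. \<forall>t. t \<notin> Z \<longrightarrow> poly r t / (\<Prod>z\<in>Z. t - z) = (\<Sum>z\<in>Z. c z / (t - z))"
  using assms
proof (induction Z arbitrary: r rule: finite_induct)
  case (insert b Z)
  define W where "W = (\<Prod>z\<in>Z. [:-z, 1:])"
  have W: "poly W t = (\<Prod>z\<in>Z. t - z)" for t by (simp add: W_def poly_prod)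
  have dW: "degree W = card Z" unfolding W_def by (subst degree_prod_eq_sum_degree) auto
  have Wb: "poly W b \<noteq> 0" unfolding W using insert.hyps by (auto simp: prod_zero_iff)
  \<comment> \<open>The coefficient at the pole b, chosen so that r - c0 W is divisible by t - b. As
    W has degree card Z, the quotient u is either 0 or of degree below card Z, as the induction
    requires.\<close>
  define c0 where "c0 = poly r b / poly W b"
  have "poly (r - smult c0 W) b = 0" using Wb by (simp add: c0_def)
  then obtain u where u: "r - smult c0 W = [:-b, 1:] * u" by (metis poly_eq_0_iff_dvd dvdE)
  have deg: "degree (r - smult c0 W) \<le> card Z"
    using insert.prems insert.hyps dW degree_smult_le[of c0 W] by (intro degree_diff_le) auto
  have "\<exists>c. \<forall>t. t \<notin> Z \<longrightarrow> poly u t / (\<Prod>z\<in>Z. t - z) = (\<Sum>z\<in>Z. c z / (t - z))"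
  proof (cases "u = 0")
    case False
    then have "degree (r - smult c0 W) = Suc (degree u)"
      unfolding u by (subst degree_mult_eq) auto
    then show ?thesis using deg by (intro insert.IH) auto
  qed (auto intro: exI[of _ "\<lambda>_. 0"])
  then obtain c where c: "\<And>t. t \<notin> Z \<Longrightarrow> poly u t / (\<Prod>z\<in>Z. t - z) = (\<Sum>z\<in>Z. c z / (t - z))" by blast
  show ?case
  proof (intro exI[of _ "\<lambda>z. if z = b then c0 else c z"] allI impI)
    fix t assume t: "t \<notin> insert b Z"
    have Wt: "poly W t \<noteq> 0" unfolding W using t insert.hyps by (auto simp: prod_zero_iff)
    have "poly r t = c0 * poly W t + (t - b) * poly u t"
      using arg_cong[OF u, of "\<lambda>q. poly q t"] by (simp add: algebra_simps)
    then have "poly r t / (\<Prod>z\<in>insert b Z. t - z) = c0 / (t - b) + poly u t / poly W t"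
      using insert.hyps t Wt by (simp add: W[symmetric] field_simps)
    also have "\<dots> = c0 / (t - b) + (\<Sum>z\<in>Z. c z / (t - z))" using c t W by simp
    also have "\<dots> = (\<Sum>z\<in>insert b Z. (if z = b then c0 else c z) / (t - z))"
      using insert.hyps by (auto intro!: sum.cong)
    finally show "poly r t / (\<Prod>z\<in>insert b Z. t - z) = (\<Sum>z\<in>insert b Z. (if z = b then c0 else c z) / (t - z))" .
  qed
qed simp

lemma cauchy_integral_continuous:
  fixes f :: "real \<Rightarrow> real"
  assumes s: "s \<in> class_M D" and f: "integrable (mmod s) f" and SD: "S \<inter> D = {}"
  shows "continuous_on S (\<lambda>x. cs_integral s (\<lambda>t. f t / (x - t)))"
proof (rule continuous_on_sequentiallyI)
  fix u a assume u: "\<forall>n. u n \<in> S" and a: "a \<in> S" and lim: "u \<longlonglongrightarrow> a"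
  define F where "F x = (\<integral>t. f t / (x - t) \<partial>mmod s)" for x
  have int: "integrable (mmod s) (\<lambda>t. f t / (x - t))" if "x \<in> S" for x
    using that SD by (intro integrable_over_linear_real[OF s _ f]) auto
  have "a \<notin> D" using a SD by auto
  then obtain d where d: "d > 0" "AE t in mmod s. d \<le> \<bar>a - t\<bar>"
    using dist_outside_real[OF s] by blast
  have "(\<lambda>n. F (u n) - F a) \<longlonglongrightarrow> 0"
  proof (rule Lim_null_comparison)
    have "(\<lambda>n. u n - a) \<longlonglongrightarrow> 0" using lim by (simp add: LIM_zero_iff)
    then have "(\<lambda>n. \<bar>u n - a\<bar>) \<longlonglongrightarrow> 0" by (rule tendsto_rabs_zero)
    \<comment> \<open>The constant 2/d^2 bounds 1/(|u n - t| |a - t|): here |a - t| >= d, and |u n -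
      t| >= d/2 as soon as |u n - a| < d/2.\<close>
    then show "(\<lambda>n. \<bar>u n - a\<bar> * (2 / d\<^sup>2 * (\<integral>t. \<bar>f t\<bar> \<partial>mmod s))) \<longlonglongrightarrow> 0"
      by (rule tendsto_mult_left_zero)
    have "\<forall>\<^sub>F n in sequentially. dist (u n) a < d / 2"
      using tendstoD[OF lim, of "d / 2"] d(1) by simp
    then show "\<forall>\<^sub>F n in sequentially. norm (F (u n) - F a) \<le> \<bar>u n - a\<bar> * (2 / d\<^sup>2 * (\<integral>t. \<bar>f t\<bar> \<partial>mmod s))"
    proof eventually_elim
      case (elim n)
      have "norm (F (u n) - F a) = \<bar>\<integral>t. f t / (u n - t) - f t / (a - t) \<partial>mmod s\<bar>"
        unfolding F_def using int u a by (subst Bochner_Integration.integral_diff) auto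
      also have "\<dots> \<le> (\<integral>t. \<bar>f t / (u n - t) - f t / (a - t)\<bar> \<partial>mmod s)"
        by (rule integral_abs_bound)
      also have "\<dots> \<le> (\<integral>t. \<bar>u n - a\<bar> * (2 / d\<^sup>2) * \<bar>f t\<bar> \<partial>mmod s)"
      proof (rule integral_mono_AE)
        show "integrable (mmod s) (\<lambda>t. \<bar>f t / (u n - t) - f t / (a - t)\<bar>)"
          using int u a by (intro integrable_abs Bochner_Integration.integrable_diff) auto
        show "integrable (mmod s) (\<lambda>t. \<bar>u n - a\<bar> * (2 / d\<^sup>2) * \<bar>f t\<bar>)"
          using f by (intro integrable_mult_right integrable_abs)
        show "AE t in mmod s. \<bar>f t / (u n - t) - f t / (a - t)\<bar> \<le> \<bar>u n - a\<bar> * (2 / d\<^sup>2) * \<bar>f t\<bar>"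
          using d(2)
        proof eventually_elim
          fix t assume t: "d \<le> \<bar>a - t\<bar>"
          have un: "d / 2 \<le> \<bar>u n - t\<bar>" using t elim unfolding dist_real_def by argo
          then have nz: "u n - t \<noteq> 0" "a - t \<noteq> 0" using d(1) t by auto
          have "f t / (u n - t) - f t / (a - t) = f t * (a - u n) / ((u n - t) * (a - t))"
            using nz by (simp add: field_simps)
          then have "\<bar>f t / (u n - t) - f t / (a - t)\<bar> = (\<bar>u n - a\<bar> * \<bar>f t\<bar>) / (\<bar>u n - t\<bar> * \<bar>a - t\<bar>)"
            by (simp add: abs_mult abs_minus_commute)
          also have "\<dots> \<le> (\<bar>u n - a\<bar> * \<bar>f t\<bar>) / (d / 2 * d)"
            using un t d(1) nz by (intro divide_left_mono mult_mono mult_pos_pos mult_nonneg_nonneg) auto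
          also have "\<dots> = \<bar>u n - a\<bar> * (2 / d\<^sup>2) * \<bar>f t\<bar>"
            using d(1) by (simp add: power2_eq_square field_simps)
          finally show "\<bar>f t / (u n - t) - f t / (a - t)\<bar> \<le> \<bar>u n - a\<bar> * (2 / d\<^sup>2) * \<bar>f t\<bar>" .
        qed
      qed
      finally show ?case by simp
    qed
  qed
  then have "(\<lambda>n. F (u n)) \<longlonglongrightarrow> F a" by (simp add: LIM_zero_iff)
  then show "(\<lambda>n. cs_integral s (\<lambda>t. f t / (u n - t))) \<longlonglongrightarrow> cs_integral s (\<lambda>t. f t / (a - t))"
    unfolding cs_integral_def F_def by (intro tendsto_scaleR tendsto_const)
qed

lemma poly_map_Re: "poly (map_poly Re p) x = Re (poly p (of_real x))"
  by (induction p) (simp_all add: map_poly_pCons)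

context nikishin
begin

section \<open>Propagation of zeros through the intervals\<close>

lemma Re_G_integrable:
  assumes "1 \<le> j" "j \<le> m"
  shows "integrable (mu j) (\<lambda>x. Re (G p j x))"
  using integrable_Re[OF G_integrable[OF assms, of 1 p]] by simp

text \<open>The kernels and measures are real, so real parts satisfy the same recursion; counting
  sign changes requires real functions.\<close>

lemma Re_G_Suc:
  assumes j: "1 \<le> j" "j < m" and x: "x \<in> E j"
  shows "Re (G p j x) = cs_integral (\<sigma> (Suc j)) (\<lambda>t. Re (G p (Suc j) t) / (x - t))"
proof -
  have s: "\<sigma> (Suc j) \<in> class_M (\<Delta> (Suc j))" using j by (intro sigma_class) auto
  have "integrable (mu (Suc j)) (G p (Suc j))" using G_integrable[of "Suc j" 1 p] j by simp
  moreover have "complex_of_real x \<notin> of_real ` \<Delta> (Suc j)" using E_next[OF x j(2)] by auto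
  ultimately have "integrable (mu (Suc j)) (\<lambda>t. G p (Suc j) t / (of_real x - of_real t))"
    by (intro integrable_over_linear[OF s])
  from cs_integral_Re[OF this] show ?thesis
    unfolding G_Suc[OF j x] by (simp flip: of_real_diff)
qed

lemma Re_G_continuous:
  assumes "1 \<le> j" "j \<le> m"
  shows "continuous_on (E j) (\<lambda>x. Re (G p j x))"
proof (cases "j = m")
  case True
  then show ?thesis unfolding G_def by (auto intro!: continuous_intros)
next
  case False
  then have j: "1 \<le> j" "j < m" using assms by auto
  have "continuous_on (E j) (\<lambda>x. cs_integral (\<sigma> (Suc j)) (\<lambda>t. Re (G p (Suc j) t) / (x - t)))"
    using j E_next by (intro cauchy_integral_continuous[OF sigma_class[of "Suc j"]] Re_G_integrable) auto
  then show ?thesis using Re_G_Suc[OF j] by (simp cong: continuous_on_cong)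
qed

text \<open>If \<open>Re G\<^sub>j\<close> vanishes on \<open>Z\<close>, partial fractions turn this into orthogonality of
  \<open>Re G\<^sub>j\<^sub>+\<^sub>1 / \<Prod>\<^sub>z\<^sub>\<in>\<^sub>Z (t - z)\<close> to all polynomials of degree below \<open>card Z\<close>.\<close>

lemma zeros_step:
  assumes j: "1 \<le> j" "j < m" and Z: "Z \<subseteq> E j" "finite Z" "card Z = N" "\<forall>z\<in>Z. Re (G p j z) = 0"
  shows "\<exists>Z\<subseteq>E (Suc j). finite Z \<and> card Z = N \<and> (\<forall>z\<in>Z. Re (G p (Suc j) z) = 0)"
proof -
  let ?g = "\<lambda>t. Re (G p (Suc j) t)"
  let ?W = "\<lambda>t. \<Prod>z\<in>Z. t - z"
  have j': "1 \<le> Suc j" "Suc j \<le> m" using j by auto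
  note s = sigma_class[OF j']
  have [measurable]: "G p (Suc j) \<in> borel_measurable borel" by (rule G_measurable[OF j'])
  note [measurable_cong] = mu_sets[OF j']
  have notZ: "t \<notin> Z" if "t \<in> E (Suc j)" for t using E_disjoint[of j] j that Z(1) by auto
  \<comment> \<open>Z lies in \<open>E j\<close>, which is disjoint from \<open>E (Suc j)\<close>;
    hence dividing by the product keeps continuity and does not alter the zeros there.\<close>
  have W: "?W t \<noteq> 0" if "t \<in> E (Suc j)" for t
    using notZ[OF that] Z(2) by (auto simp: prod_zero_iff)
  have int: "integrable (mu (Suc j)) (\<lambda>t. ?g t / (z - t))" if "z \<in> Z" for z
    using that Z(1) E_next j by (intro integrable_over_linear_real[OF s] Re_G_integrable j') auto
  have zero: "(\<integral>t. ?g t / (z - t) \<partial>mu (Suc j)) = 0" if "z \<in> Z" for z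
  proof -
    have "cs_integral (\<sigma> (Suc j)) (\<lambda>t. ?g t / (z - t)) = 0"
      using Re_G_Suc[OF j, of z p] Z(1,4) that by auto
    then show ?thesis using sigma_sign[OF j'] by (auto simp: cs_integral_def)
  qed
  have main: "integrable (mu (Suc j)) (\<lambda>t. t ^ \<nu> * (?g t / ?W t)) \<and>
      (\<integral>t. t ^ \<nu> * (?g t / ?W t) \<partial>mu (Suc j)) = 0" if "\<nu> < N" for \<nu>
  proof -
    have "degree (monom (1::real) \<nu>) < card Z" using that Z(3) by (simp add: degree_monom_eq)
    from partial_fractions[OF Z(2) this]
    obtain c where c: "\<And>t. t \<notin> Z \<Longrightarrow> t ^ \<nu> / ?W t = (\<Sum>z\<in>Z. c z / (t - z))"
      by (auto simp: poly_monom)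
    have AE: "AE t in mu (Suc j). t ^ \<nu> * (?g t / ?W t) = (\<Sum>z\<in>Z. - c z * (?g t / (z - t)))"
      using AE_E[OF j']
    proof eventually_elim
      case (elim t)
      have "t ^ \<nu> * (?g t / ?W t) = (t ^ \<nu> / ?W t) * ?g t" by simp
      also have "\<dots> = (\<Sum>z\<in>Z. c z / (t - z)) * ?g t" using c notZ[OF elim] by simp
      also have "\<dots> = (\<Sum>z\<in>Z. - c z * (?g t / (z - t)))"
        unfolding sum_distrib_right
      proof (rule sum.cong[OF refl])
        fix z assume "z \<in> Z"
        then have "t - z \<noteq> 0" "z - t \<noteq> 0" using notZ[OF elim] by auto
        then show "c z / (t - z) * ?g t = - c z * (?g t / (z - t))" by (simp add: field_simps)
      qed
      finally show ?case .
    qed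
    have i: "integrable (mu (Suc j)) (\<lambda>t. \<Sum>z\<in>Z. - c z * (?g t / (z - t)))"
      by (intro Bochner_Integration.integrable_sum integrable_mult_right int)
    have "integrable (mu (Suc j)) (\<lambda>t. t ^ \<nu> * (?g t / ?W t))"
      using i by (subst integrable_cong_AE[OF _ _ AE]) measurable
    moreover have "(\<integral>t. t ^ \<nu> * (?g t / ?W t) \<partial>mu (Suc j)) = (\<integral>t. (\<Sum>z\<in>Z. - c z * (?g t / (z - t))) \<partial>mu (Suc j))"
      by (rule integral_cong_AE[OF _ _ AE]) measurable
    moreover have "\<dots> = (\<Sum>z\<in>Z. \<integral>t. - c z * (?g t / (z - t)) \<partial>mu (Suc j))"
      by (intro Bochner_Integration.integral_sum integrable_mult_right int)
    moreover have "\<dots> = 0"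
      unfolding integral_mult_right_zero using zero by simp
    ultimately show ?thesis by simp
  qed
  have "continuous_on (E (Suc j)) (\<lambda>t. ?g t / ?W t)"
    using W by (intro continuous_on_divide Re_G_continuous j') (auto intro!: continuous_intros)
  then obtain Y where Y: "Y \<subseteq> E (Suc j)" "finite Y" "card Y = N" "\<forall>z\<in>Y. ?g z / ?W z = 0"
    using zeros_of_orthogonal[OF s E_interval[OF j'] AE_E[OF j'], of "\<lambda>t. ?g t / ?W t" N] main by blast
  have "\<forall>z\<in>Y. ?g z = 0"
  proof
    fix z assume z: "z \<in> Y"
    then have "?W z \<noteq> 0" using Y(1) W by blast
    then show "?g z = 0" using Y(4) z by (metis divide_eq_0_iff)
  qed
  then show ?thesis using Y by blast
qed

text \<open>The test monomials are real on the line, so the real part of G inherits the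
  orthogonality. At level m the N zeros belong to \<open>map_poly Re p\<close>, whose degree is
  below N.\<close>

lemma Re_part_zero:
  assumes deg: "degree p < N"
    and orth: "\<And>\<nu>. \<nu> < N \<Longrightarrow> cs_integral (\<sigma> 1) (\<lambda>x. of_real x ^ \<nu> * G p 1 x) = 0"
  shows "map_poly Re p = 0"
proof -
  have m1: "1 \<le> (1::nat)" "1 \<le> m" using m2 by auto
  have int: "integrable (mu 1) (\<lambda>x. of_real x ^ \<nu> * G p 1 x)" for \<nu>
    using G_integrable[OF m1, of "monom 1 \<nu>" p] by (simp add: poly_monom)
  have Re_eq: "Re (of_real x ^ \<nu> * w) = x ^ \<nu> * Re w" for x \<nu> and w :: complex
    by (simp flip: of_real_power)
  have "\<exists>Z\<subseteq>E 1. finite Z \<and> card Z = N \<and> (\<forall>z\<in>Z. Re (G p 1 z) = 0)"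
  proof (rule zeros_of_orthogonal[OF sigma_class[OF m1] E_interval[OF m1] AE_E[OF m1] Re_G_continuous[OF m1]])
    fix \<nu> assume \<nu>: "\<nu> < N"
    show "integrable (mu 1) (\<lambda>x. x ^ \<nu> * Re (G p 1 x))"
      using integrable_Re[OF int[of \<nu>]] by (simp only: Re_eq)
    have "cs_integral (\<sigma> 1) (\<lambda>x. x ^ \<nu> * Re (G p 1 x)) = 0"
      using cs_integral_Re[OF int[of \<nu>]] orth[OF \<nu>] by (simp only: Re_eq zero_complex.sel)
    then show "(\<integral>x. x ^ \<nu> * Re (G p 1 x) \<partial>mu 1) = 0"
      using sigma_sign[OF m1] by (auto simp: cs_integral_def)
  qed
  have "\<exists>Z\<subseteq>E j. finite Z \<and> card Z = N \<and> (\<forall>z\<in>Z. Re (G p j z) = 0)" if "1 \<le> j" "j \<le> m" for j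
    using that
  proof (induction j rule: dec_induct)
    case base
    show ?case by (rule \<open>\<exists>Z\<subseteq>E 1. finite Z \<and> card Z = N \<and> (\<forall>z\<in>Z. Re (G p 1 z) = 0)\<close>)
  next
    case (step j)
    then show ?case using zeros_step[of j] by (metis Suc_leD Suc_le_lessD)
  qed
  from this[OF m1(2) order_refl] obtain Z where Z: "finite Z" "card Z = N" "\<forall>z\<in>Z. Re (G p m z) = 0" by blast
  show ?thesis
  proof (rule ccontr)
    assume nz: "map_poly Re p \<noteq> 0"
    have "Z \<subseteq> {x. poly (map_poly Re p) x = 0}" using Z(3) by (auto simp: G_def poly_map_Re)
    then have "N \<le> card {x. poly (map_poly Re p) x = 0}"
      using Z(2) poly_roots_finite[OF nz] card_mono by blast
    also have "\<dots> \<le> degree (map_poly Re p)" by (rule card_poly_roots_bound[OF nz])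
    also have "\<dots> \<le> degree p" by (rule degree_le) (simp add: coeff_map_poly coeff_eq_0)
    finally show False using deg by simp
  qed
qed

lemma G_smult: "G (smult c p) j x = c * G p j x"
  by (simp add: G_def cs_integral_mult_left[symmetric] mult.left_commute)

lemma moments_nondegenerate:
  assumes deg: "degree p < N"
    and orth: "\<And>\<nu>. \<nu> < N \<Longrightarrow> cs_integral (\<sigma> 1) (\<lambda>x. of_real x ^ \<nu> * G p 1 x) = 0"
  shows "p = 0"
proof -
  have "map_poly Re p = 0" by (rule Re_part_zero[OF deg orth])
  \<comment> \<open>Re(-iw) = Im w, so this is the imaginary part of p.\<close>
  moreover have "map_poly Re (smult (- \<i>) p) = 0"
  proof (rule Re_part_zero)
    show "degree (smult (- \<i>) p) < N" using deg by simp
    fix \<nu> assume "\<nu> < N"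
    have "(\<lambda>x. of_real x ^ \<nu> * G (smult (- \<i>) p) 1 x) = (\<lambda>x. (- \<i>) * (of_real x ^ \<nu> * G p 1 x))"
      by (simp only: G_smult mult.left_commute)
    then show "cs_integral (\<sigma> 1) (\<lambda>x. of_real x ^ \<nu> * G (smult (- \<i>) p) 1 x) = 0"
      using orth[OF \<open>\<nu> < N\<close>] cs_integral_mult_left[of "\<sigma> 1" "- \<i>"] by simp
  qed
  ultimately have "Re (coeff p i) = 0" "Im (coeff p i) = 0" for i
    by (metis coeff_0 coeff_map_poly zero_complex.sel(1),
        use \<open>map_poly Re (smult (- \<i>) p) = 0\<close> coeff_map_poly[of Re "smult (- \<i>) p" i] in simp)
  then show ?thesis by (intro poly_eqI) (simp add: complex_eq_iff)
qed

end

section \<open>Biorthogonality\<close>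

text \<open>The indices match because m + 1 - (j + 1) = m - j and m + 1 - k = m - k + 1 for k <=
  m.\<close>

lemma multilevel_HP_rev_reflect:
  assumes "multilevel_HP_rev m \<Delta> \<sigma> n b" "0 < m"
  shows "multilevel_HP m (\<lambda>i. \<Delta> (Suc m - i)) (\<lambda>i. \<sigma> (Suc m - i)) n b"
proof -
  have "ml_form m (\<lambda>j k. nik \<sigma> (m - j) (m - k + 1)) b j =
      ml_form m (\<lambda>j k. nik (\<lambda>i. \<sigma> (Suc m - i)) (j + 1) k) b j" if "j < m" for j
    unfolding ml_form_def using that by (auto simp: fun_eq_iff nik_reflect Suc_diff_le intro!: sum.cong)
  then show ?thesis
    using assms unfolding multilevel_HP_def multilevel_HP_rev_def ml_hermite_pade_def
    by simp
qed

context nikishin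
begin

definition pairing :: "complex poly \<Rightarrow> complex poly \<Rightarrow> complex" where
  "pairing q p = cs_integral (\<sigma> 1) (\<lambda>x. cs_integral (\<sigma> m) (biorth_integrand m \<sigma> q p x))"

lemma m_pos: "0 < m"
  using m2 by simp

lemma cauchy_conv_kernel_eq: "cauchy_conv_kernel m \<sigma> = chain_kernel (map \<sigma> [Suc 1..<m])"
  by (simp add: cauchy_conv_kernel_def numeral_2_eq_2)

lemma biorth_integrable:
  "integrable (mu 1 \<Otimes>\<^sub>M mu m) (\<lambda>(x, y). biorth_integrand m \<sigma> q p x y)"
  using chain_kernel_integrable[of 1 q p] m2
  by (simp add: biorth_integrand_def cauchy_conv_kernel_def numeral_2_eq_2)

lemma biorth_measurable:
  assumes [measurable]: "f \<in> borel_measurable N" "g \<in> borel_measurable N"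
  shows "(\<lambda>x. biorth_integrand m \<sigma> q p (f x) (g x)) \<in> borel_measurable N"
proof -
  have [measurable]: "(\<lambda>x. chain_kernel (map \<sigma> [2..<m]) (f x) (g x)) \<in> borel_measurable N"
    using m2 by (intro chain_kernel_measurable2 list_chain_measurable assms) auto
  note [measurable] = measurable_compose[OF _ poly_of_real_measurable]
  show ?thesis unfolding biorth_integrand_def cauchy_conv_kernel_def by measurable
qed

lemma pair_mu: "pair_sigma_finite (mu 1) (mu m)"
  using m2 by (intro borel_finite_pair mu_borel_finite) auto

lemma biorth_AE_integrable: "AE x in mu 1. integrable (mu m) (biorth_integrand m \<sigma> q p x)"
  by (rule pair_sigma_finite.AE_integrable_fst[OF pair_mu biorth_integrable])

lemma cs_integral_biorth:
  "cs_integral (\<sigma> m) (biorth_integrand m \<sigma> q p x) = poly q (of_real x) * G p 1 x"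
  using m2 by (simp add: biorth_integrand_def[abs_def] cauchy_conv_kernel_def numeral_2_eq_2 G_def
      mult.assoc cs_integral_mult_left)

lemma biorth_outer_integrable:
  "integrable (mu 1) (\<lambda>x. cs_integral (\<sigma> m) (biorth_integrand m \<sigma> q p x))"
  unfolding cs_integral_biorth using m2 by (intro G_integrable) auto

lemma pairing_eq_G: "pairing q p = cs_integral (\<sigma> 1) (\<lambda>x. poly q (of_real x) * G p 1 x)"
  by (simp add: pairing_def cs_integral_biorth)

lemma pairing_add: "pairing (q + r) p = pairing q p + pairing r p"
  unfolding pairing_eq_G poly_add distrib_right
  using m2 by (intro cs_integral_add G_integrable) auto

lemma pairing_smult: "pairing (smult c q) p = c * pairing q p"
  by (simp add: pairing_eq_G mult.assoc cs_integral_mult_left)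

lemma pairing_sum: "pairing (\<Sum>i\<in>I. f i) p = (\<Sum>i\<in>I. pairing (f i) p)"
proof -
  have "pairing 0 p = 0" using pairing_smult[of 0 0 p] by simp
  then show ?thesis by (induction I rule: infinite_finite_induct) (auto simp: pairing_add)
qed

lemma pairing_HP:
  assumes "multilevel_HP m \<Delta> \<sigma> n a" "degree q < n"
  shows "pairing q (a m) = 0"
proof -
  have "pairing (monom 1 i) (a m) = 0" if "i \<le> degree q" for i
    using HP_orthogonal[OF assms(1), of i] that assms(2) by (simp add: pairing_eq_G poly_monom)
  then have "(\<Sum>i\<le>degree q. pairing (smult (coeff q i) (monom 1 i)) (a m)) = 0"
    by (intro sum.neutral) (simp add: pairing_smult)
  moreover have "q = (\<Sum>i\<le>degree q. smult (coeff q i) (monom 1 i))"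
    by (simp add: smult_monom poly_as_sum_of_monoms)
  ultimately show ?thesis by (metis pairing_sum)
qed

lemma pairing_nondegenerate:
  assumes "degree p < N" "\<And>q. degree q < N \<Longrightarrow> pairing q p = 0"
  shows "p = 0"
proof (rule moments_nondegenerate[OF assms(1)])
  fix \<nu> assume "\<nu> < N"
  then have "pairing (monom 1 \<nu>) p = 0" by (intro assms(2)) (simp add: degree_monom_eq)
  then show "cs_integral (\<sigma> 1) (\<lambda>x. of_real x ^ \<nu> * G p 1 x) = 0"
    by (simp add: pairing_eq_G poly_monom)
qed

section \<open>The pairing of the reversed system\<close>

abbreviation reflected_pairing :: "complex poly \<Rightarrow> complex poly \<Rightarrow> complex" where
  "reflected_pairing \<equiv> nikishin.pairing m (\<lambda>i. \<sigma> (Suc m - i))"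

text \<open>On \<open>E 1\<close> x \<open>E m\<close> both kernels are a sign times the same
  nonnegative kernel, and Fubini exchanges the variables. Knowing c up to sign is enough, as only
  vanishing is transferred.\<close>

lemma reflected_pairing: "\<exists>c\<in>{1, -1}. \<forall>p q. reflected_pairing p q = c * pairing q p"
proof -
  interpret R: nikishin m "\<lambda>i. \<Delta> (Suc m - i)" "\<lambda>i. \<sigma> (Suc m - i)"
    by (rule nikishin_reflect)
  have m1: "1 < m" "1 \<le> m" using m2 by auto
  have ends: "Suc m - m = 1" "Suc m - 1 = m" by auto
  have RE: "R.E 1 = E m" "R.E m = E 1"
    using m2 unfolding R.E_def E_def by (auto simp: Suc_diff_le numeral_2_eq_2)
  have lists: "map (\<lambda>i. f (Suc m - i)) [Suc 1..<m] = rev (map f [Suc 1..<m])" for f :: "nat \<Rightarrow> 'z"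
    using map_reflect_upt[of m m f "Suc 1"] m2 by (simp add: numeral_2_eq_2)
  let ?K = "cauchy_conv_kernel m \<sigma>" and ?R = "cauchy_conv_kernel m (\<lambda>i. \<sigma> (Suc m - i))"
  let ?a = "abs_kernel (map mu [Suc 1..<m])"
  obtain c1 where c1: "c1 \<in> {1, -1}" "\<And>x y. x \<in> E 1 \<Longrightarrow> y \<in> E m \<Longrightarrow> ?K x y = c1 * enn2real (?a x y)"
    using chain_kernel_eq_abs[OF order_refl m1(1) order_refl] unfolding cauchy_conv_kernel_eq by blast
  have bf: "list_all borel_finite (map mu [Suc 1..<m])" by (intro list_borel_finite) auto
  obtain c2 where c2: "c2 \<in> {1, -1}" "\<And>x y. x \<in> E 1 \<Longrightarrow> y \<in> E m \<Longrightarrow> ?R y x = c2 * enn2real (?a x y)"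
    using R.chain_kernel_eq_abs[OF order_refl m1(1) order_refl]
    unfolding RE lists[of mu] abs_kernel_rev[OF bf] R.cauchy_conv_kernel_eq by blast
  define c where "c = c1 * c2"
  have c: "c \<in> {1, -1}" using c1 c2 by (auto simp: c_def)
  have K: "?R y x = c * ?K x y" if "x \<in> E 1" "y \<in> E m" for x y
    using c1(1) c1(2)[OF that] c2(2)[OF that] by (auto simp: c_def)
  note bm = mu_borel_finite[OF order_refl m1(2)] mu_borel_finite[OF m1(2) order_refl]
  note [measurable_cong] = borel_finite_sets[OF bm(1)] borel_finite_sets[OF bm(2)]
  have "reflected_pairing p q = of_real c * pairing q p" for p q
  proof -
    have R: "biorth_integrand m (\<lambda>i. \<sigma> (Suc m - i)) p q y x = of_real c * biorth_integrand m \<sigma> q p x y"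
      if "x \<in> E 1" "y \<in> E m" for x y
      unfolding biorth_integrand_def K[OF that] by simp
    have intR: "integrable (mu m \<Otimes>\<^sub>M mu 1) (\<lambda>(y, x). biorth_integrand m (\<lambda>i. \<sigma> (Suc m - i)) p q y x)"
      using R.biorth_integrable[of p q] by (simp only: ends)
    have "pairing q p = cs_integral (\<sigma> m) (\<lambda>y. cs_integral (\<sigma> 1) (\<lambda>x. biorth_integrand m \<sigma> q p x y))"
      unfolding pairing_def by (rule cs_integral_swap[OF bm biorth_integrable])
    then have "of_real c * pairing q p =
      cs_integral (\<sigma> m) (\<lambda>y. cs_integral (\<sigma> 1) (\<lambda>x. of_real c * biorth_integrand m \<sigma> q p x y))"
      by (simp add: cs_integral_mult_left)
    also have "\<dots> = cs_integral (\<sigma> m) (\<lambda>y. cs_integral (\<sigma> 1) (\<lambda>x. biorth_integrand m (\<lambda>i. \<sigma> (Suc m - i)) p q y x))"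
    proof (rule cs_integral_cong_AE)
      note [measurable] = biorth_measurable R.biorth_measurable
      show "(\<lambda>y. cs_integral (\<sigma> 1) (\<lambda>x. of_real c * biorth_integrand m \<sigma> q p x y)) \<in> borel_measurable (mu m)"
        unfolding cs_integral_mult_left cs_integral_def
        using pair_sigma_finite.integrable_snd[OF pair_mu biorth_integrable, of q p]
        by (intro borel_measurable_times borel_measurable_scaleR borel_measurable_const) auto
      show "(\<lambda>y. cs_integral (\<sigma> 1) (\<lambda>x. biorth_integrand m (\<lambda>i. \<sigma> (Suc m - i)) p q y x)) \<in> borel_measurable (mu m)"
        using R.biorth_outer_integrable[of p q] by (simp only: ends borel_measurable_integrable)
      show "AE y in mu m. cs_integral (\<sigma> 1) (\<lambda>x. of_real c * biorth_integrand m \<sigma> q p x y) =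
          cs_integral (\<sigma> 1) (\<lambda>x. biorth_integrand m (\<lambda>i. \<sigma> (Suc m - i)) p q y x)"
        using AE_E[OF m1(2) order_refl]
      proof eventually_elim
        case (elim y)
        show ?case
        proof (rule cs_integral_cong_AE)
          show "AE x in mu 1. of_real c * biorth_integrand m \<sigma> q p x y =
              biorth_integrand m (\<lambda>i. \<sigma> (Suc m - i)) p q y x"
            using AE_E[OF order_refl m1(2)] by eventually_elim (use R[OF _ elim] in simp)
        qed measurable
      qed
    qed
    also have "\<dots> = reflected_pairing p q"
      unfolding R.pairing_def by (simp only: ends)
    finally show ?thesis by simp
  qed
  then show ?thesis using c by (intro bexI[of _ "complex_of_real c"]) auto
qed

lemma pairing_HP_rev:
  assumes "multilevel_HP_rev m \<Delta> \<sigma> n b" "degree p < n"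
  shows "pairing (b m) p = 0"
proof -
  have "reflected_pairing p (b m) = 0"
    by (rule nikishin.pairing_HP[OF nikishin_reflect multilevel_HP_rev_reflect[OF assms(1) m_pos] assms(2)])
  moreover obtain c where "c \<in> {1, -1}" "reflected_pairing p (b m) = c * pairing (b m) p"
    using reflected_pairing by blast
  ultimately show ?thesis by auto
qed

text \<open>If the degree were below n, orthogonality to all degrees below n would force
  \<open>a m\<close> = 0 by nondegeneracy. Exactness of the degree is what lets \<open>b m\<close>
  supply the missing power in \<open>pairing_diagonal\<close>.\<close>

lemma HP_degree:
  assumes "multilevel_HP m \<Delta> \<sigma> n a"
  shows "degree (a m) = n"
proof (rule ccontr)
  assume "degree (a m) \<noteq> n"
  moreover have "degree (a m) \<le> n"
    using assms unfolding multilevel_HP_def ml_hermite_pade_def by blast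
  ultimately have "a m = 0"
    using pairing_HP[OF assms] by (intro pairing_nondegenerate[of "a m" n]) auto
  then show False using HP_leading_nonzero[OF assms] by simp
qed

lemma pairing_diagonal:
  assumes a: "multilevel_HP m \<Delta> \<sigma> n a" and b: "multilevel_HP_rev m \<Delta> \<sigma> n b" and n: "1 \<le> n"
  shows "pairing (b m) (a m) \<noteq> 0"
proof
  assume zero: "pairing (b m) (a m) = 0"
  note b' = multilevel_HP_rev_reflect[OF b m_pos]
  have "degree (b m) = n" by (rule nikishin.HP_degree[OF nikishin_reflect b'])
  then have lc: "coeff (b m) n \<noteq> 0" using n by (metis leading_coeff_0_iff degree_0 not_one_le_zero)
  have "pairing q (a m) = 0" if "degree q < Suc n" for q
  proof -
    \<comment> \<open>Cancels the coefficient of x^n in q, leaving a remainder to which the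
      orthogonality of \<open>a m\<close> applies.\<close>
    define c where "c = coeff q n / coeff (b m) n"
    define r where "r = q - smult c (b m)"
    have "degree r \<le> n"
      unfolding r_def using that \<open>degree (b m) = n\<close> degree_smult_le[of c "b m"]
      by (intro degree_diff_le) auto
    moreover have "coeff r n = 0" using lc by (simp add: r_def c_def)
    \<comment> \<open>Here n >= 1 covers r = 0, whose degree is 0 by convention.\<close>
    ultimately have "degree r < n"
      using n by (metis leading_coeff_0_iff degree_0 le_neq_implies_less less_one linorder_not_le)
    moreover have "q = smult c (b m) + r" by (simp add: r_def)
    ultimately show ?thesis
      using pairing_HP[OF a] zero by (metis pairing_add pairing_smult mult_zero_right add_0)
  qed
  moreover have "degree (a m) < Suc n" using HP_degree[OF a] by simp
  ultimately have "a m = 0" by (intro pairing_nondegenerate[of "a m" "Suc n"]) auto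
  then show False using HP_leading_nonzero[OF a] by simp
qed

end

theorem theorem1p5:
  fixes m :: nat and \<Delta> :: "nat \<Rightarrow> real set" and \<sigma> :: "nat \<Rightarrow> csmeasure"
    and a b :: "nat \<Rightarrow> nat \<Rightarrow> complex poly"
  assumes "m \<ge> 2"
    and "nikishin_generators m \<Delta> \<sigma>"
    and "\<And>n. n \<ge> 1 \<Longrightarrow> multilevel_HP m \<Delta> \<sigma> n (a n)"
    and "\<And>k. k \<ge> 1 \<Longrightarrow> multilevel_HP_rev m \<Delta> \<sigma> k (b k)"
  shows "\<exists>h :: nat \<Rightarrow> complex. (\<forall>n\<ge>1. h n \<noteq> 0) \<and>
    (\<forall>n\<ge>1. \<forall>k\<ge>1.
       (AE x in mmod (\<sigma> 1). integrable (mmod (\<sigma> m)) (biorth_integrand m \<sigma> (b k m) (a n m) x)) \<and>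
       integrable (mmod (\<sigma> 1)) (\<lambda>x. cs_integral (\<sigma> m) (biorth_integrand m \<sigma> (b k m) (a n m) x)) \<and>
       cs_integral (\<sigma> 1) (\<lambda>x. cs_integral (\<sigma> m) (biorth_integrand m \<sigma> (b k m) (a n m) x))
         = (if k = n then h n else 0))"
proof -
  interpret nikishin m \<Delta> \<sigma> using assms(1,2) by unfold_locales
  note a = assms(3) and b = assms(4)
  have off: "pairing (b k m) (a n m) = 0" if "n \<ge> 1" "k \<ge> 1" "k \<noteq> n" for n k
  proof (cases "k < n")
    case True
    have "degree (b k m) \<le> k"
      using b[OF that(2)] unfolding multilevel_HP_rev_def ml_hermite_pade_def by blast
    then show ?thesis using True by (intro pairing_HP[OF a[OF that(1)]]) simp
  next
    case False
    have "degree (a n m) \<le> n"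
      using a[OF that(1)] unfolding multilevel_HP_def ml_hermite_pade_def by blast
    then show ?thesis using False that(3) by (intro pairing_HP_rev[OF b[OF that(2)]]) simp
  qed
  show ?thesis
  \<comment> \<open>The vectors are given without normalization, so h_n is simply the diagonal
    value, in general complex.\<close>
  proof (intro exI[of _ "\<lambda>n. pairing (b n m) (a n m)"] conjI allI impI)
    fix n k :: nat assume "1 \<le> n" "1 \<le> k"
    then show "cs_integral (\<sigma> 1) (\<lambda>x. cs_integral (\<sigma> m) (biorth_integrand m \<sigma> (b k m) (a n m) x))
        = (if k = n then pairing (b n m) (a n m) else 0)"
      using off by (simp add: pairing_def[symmetric] del: One_nat_def)
  \<comment> \<open>The integrability claims ensure that the equations are about convergent
    integrals and not about the default value 0.\<close>
  qed (use pairing_diagonal[OF a b] biorth_AE_integrable biorth_outer_integrable in auto)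
qed

end
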